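(* Let $f(z)=\sum_n q_n e^{2\pi i\omega_n z}$, where $q_n\in\mathbb C\setminus\{0\}$, the $\omega_n$ are distinct real numbers, the set $\Omega=\{\omega_n\}$ is at most countable and bounded, and $\sum_n|q_n|<\infty$. Suppose that the zero set $A=\{a_n\}$ of the entire function $f$ (zeros counted with multiplicities) is contained in $\mathbb R$, and let $\mu_A=\sum_n\delta_{a_n}$. Then the Fourier transform $\hat\mu_A$ of $\mu_A$ (in the sense of distributions) is a pure point measure.
   Context: $\delta_a$ is the unit mass at the point $a$; the mass of $\mu_A$ at a point equals the multiplicity of that point as a zero of $f$. The Fourier transform of a temperate distribution $u\in S^*(\mathbb R)$ is defined by $\hat u(\varphi)=u(\hat\varphi)$ for all Schwartz functions $\varphi\in S(\mathbb R)$, where $\hat\varphi(t)=\int_{\mathbb R}\varphi(x)e^{-2\pi ixt}\,dx$. A pure point measure is a complex (locally finite) measure on $\mathbb R$ of the form $\sum_{\gamma\in\Gamma}b_\gamma\delta_\gamma$ with an at most countable set $\Gamma\subset\mathbb R$ (not necessarily discrete) and $b_\gamma\in\mathbb C$. *)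

theory Defs
  imports "HOL-Complex_Analysis.Complex_Analysis"
begin

definition vderiv :: "nat \<Rightarrow> (real \<Rightarrow> complex) \<Rightarrow> real \<Rightarrow> complex" where
  "vderiv n = ((\<lambda>g x. vector_derivative g (at x)) ^^ n)"

definition smooth :: "(real \<Rightarrow> complex) \<Rightarrow> bool" where
  "smooth \<phi> \<longleftrightarrow> (\<forall>n x. vderiv n \<phi> differentiable at x)"

definition test_functions :: "(real \<Rightarrow> complex) set" where
  "test_functions = {\<phi>. smooth \<phi> \<and> compact (closure {x. \<phi> x \<noteq> 0})}"

definition schwartz :: "(real \<Rightarrow> complex) set" where
  "schwartz = {\<phi>. smooth \<phi> \<and> (\<forall>k n. bounded (range (\<lambda>x. x ^ k *\<^sub>R vderiv n \<phi> x)))}"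

definition schwartz_seminorm :: "nat \<Rightarrow> nat \<Rightarrow> (real \<Rightarrow> complex) \<Rightarrow> real" where
  "schwartz_seminorm k n \<phi> = (SUP x. norm (x ^ k *\<^sub>R vderiv n \<phi> x))"

definition schwartz_topology :: "(real \<Rightarrow> complex) topology" where
  "schwartz_topology = topology_generated_by
     {{\<psi> \<in> schwartz. schwartz_seminorm k n (\<lambda>x. \<psi> x - \<phi> x) < e} | k n \<phi> e. \<phi> \<in> schwartz \<and> 0 < e}"

text \<open>Distributions are total functions on \<^typ>\<open>real \<Rightarrow> complex\<close>; only their values on
  \<^const>\<open>schwartz\<close> are meaningful.\<close>

definition tempered_distribution :: "((real \<Rightarrow> complex) \<Rightarrow> complex) \<Rightarrow> bool" where
  "tempered_distribution u \<longleftrightarrow>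
     (\<forall>\<phi>\<in>schwartz. \<forall>\<psi>\<in>schwartz. u (\<lambda>x. \<phi> x + \<psi> x) = u \<phi> + u \<psi>) \<and>
     (\<forall>c. \<forall>\<phi>\<in>schwartz. u (\<lambda>x. c * \<phi> x) = c * u \<phi>) \<and>
     continuous_map schwartz_topology euclidean u"

definition fourier :: "(real \<Rightarrow> complex) \<Rightarrow> real \<Rightarrow> complex" where
  "fourier \<phi> t = (LINT x|lborel. \<phi> x * exp (- 2 * of_real pi * \<i> * of_real x * of_real t))"

definition fourier_distribution ::
    "((real \<Rightarrow> complex) \<Rightarrow> complex) \<Rightarrow> (real \<Rightarrow> complex) \<Rightarrow> complex" where
  "fourier_distribution u \<phi> = u (fourier \<phi>)"

definition measure_distribution :: "real measure \<Rightarrow> (real \<Rightarrow> complex) \<Rightarrow> complex" where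
  "measure_distribution \<mu> \<phi> = (LINT x|\<mu>. \<phi> x)"

text \<open>Integrability is required explicitly, since the Bochner integral of a
  non-integrable function is \<open>0\<close>.\<close>

definition tempered_measure :: "real measure \<Rightarrow> bool" where
  "tempered_measure \<mu> \<longleftrightarrow> sets \<mu> = sets borel \<and> (\<forall>\<phi>\<in>schwartz. integrable \<mu> \<phi>) \<and>
     tempered_distribution (measure_distribution \<mu>)"

text \<open>A distribution \<open>u\<close> is the locally finite measure \<open>\<Sum>\<gamma>\<in>\<Gamma>. b \<gamma> \<cdot> \<delta>\<^sub>\<gamma>\<close>. Local finiteness is
  the summability condition. The two are compared on compactly supported smooth functions:
  the total variation of the measure may grow too fast for Schwartz functions to be integrable,
  and test functions are dense in the Schwartz space.\<close>

definition is_pure_point_measure :: "((real \<Rightarrow> complex) \<Rightarrow> complex) \<Rightarrow> bool" where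
  "is_pure_point_measure u \<longleftrightarrow>
     (\<exists>(\<Gamma> :: real set) (b :: real \<Rightarrow> complex). countable \<Gamma> \<and>
        (\<forall>K. compact K \<longrightarrow> (\<lambda>\<gamma>. norm (b \<gamma>)) summable_on (\<Gamma> \<inter> K)) \<and>
        (\<forall>\<phi>\<in>test_functions. u \<phi> = (\<Sum>\<^sub>\<infinity>\<gamma>\<in>\<Gamma>. b \<gamma> * \<phi> \<gamma>)))"

text \<open>The measure on the Borel sets of the real line with mass \<^term>\<open>zorder f (of_real x)\<close> at
  every real zero \<open>x\<close> of \<open>f\<close>. It is meant for entire \<open>f\<close> that do not vanish identically.\<close>

definition zero_measure :: "(complex \<Rightarrow> complex) \<Rightarrow> real measure" where
  "zero_measure f =
     distr (point_measure {x. f (of_real x) = 0} (\<lambda>x. of_nat (nat (zorder f (of_real x))))) borel (\<lambda>x. x)"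

lemma emeasure_zero_measure_singleton:
  "emeasure (zero_measure f) {a} =
     (if f (of_real a) = 0 then of_nat (nat (zorder f (of_real a))) else 0)"
proof -
  have "emeasure (zero_measure f) {a} =
      emeasure (point_measure {x. f (of_real x) = 0} (\<lambda>x. of_nat (nat (zorder f (of_real x)))))
        ({a} \<inter> {x. f (of_real x) = 0})"
    unfolding zero_measure_def
    by (subst emeasure_distr) (auto simp: point_measure_def intro!: arg_cong2[where f = emeasure])
  also have "\<dots> = (if f (of_real a) = 0 then of_nat (nat (zorder f (of_real a))) else 0)"
  proof (cases "f (of_real a) = 0")
    case True
    then have "{a} \<inter> {x. f (of_real x) = 0} = {a}" by auto
    with True show ?thesis
      by (simp add: emeasure_point_measure_finite2)
  next
    case False
    then have "{a} \<inter> {x. f (of_real x) = 0} = {}" by auto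
    with False show ?thesis by simp
  qed
  finally show ?thesis .
qed

end

theory Submission
  imports Defs "HOL-Probability.Characteristic_Functions" "HOL-Probability.Sinc_Integral" "HOL-Real_Asymp.Real_Asymp"
begin

text \<open>
  Let \<open>f z = (\<Sum>n. q n * e(w n * z))\<close> with \<open>e(t) = exp (2 * pi * \<i> * t)\<close>, absolutely summable
  coefficients and bounded frequencies, and let all zeros of \<open>f\<close> be real. For a test function
  \<open>\<phi>\<close> the Fourier integral extends to an entire function \<open>\<Phi>\<close> that decays like \<open>1 / (1 + x\<^sup>2)\<close>
  in horizontal strips. The residue theorem on long rectangles of height \<open>2 * s\<close> therefore
  expresses \<open>\<Sum>\<Phi> a\<close>, the sum over the zeros with multiplicity, through the integrals of
  \<open>\<Phi> * f' / f\<close> along the lines \<open>Im z = s\<close> and \<open>Im z = - s\<close>. If \<open>f' / f\<close> is on such a line an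
  absolutely convergent series \<open>\<Sum>k. b k * e(l k * x)\<close>, Fourier inversion evaluates the integral as
  \<open>\<Sum>k. b k * exp (2 * pi * s * l k) * \<phi> (l k)\<close> (with \<open>- s\<close> on the lower line), that is, as the
  integral of \<open>\<phi>\<close> against point masses at the frequencies \<open>l k\<close>, which are summable over bounded
  sets of frequencies. So the theorem rests on the following two facts about \<open>f\<close>.

  High up in the half-plane, \<open>f' / f\<close> is an absolutely convergent series
  (\<open>log_deriv_wave_series\<close>). The difficulty is to see that the spectrum of \<open>f\<close> has a lowest frequency
  \<open>m\<close> (\<open>lowest_frequency_attained\<close>). Once this is known, \<open>f z = e(m * z) * (c + r z)\<close> with \<open>c \<noteq> 0\<close>
  and with a remainder \<open>r\<close> whose coefficient norm on \<open>Im z = s\<close> tends to \<open>0\<close> as \<open>s\<close> grows, and a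
  geometric series inverts \<open>c + r\<close>. To find \<open>m\<close>, take the best exponential decay rate of \<open>f\<close> in the
  upper half-plane. A Liouville argument removes all frequencies below it. Since \<open>f\<close> has no zeros
  there, \<open>\<bar>f z\<bar> = C * exp (- 2 * pi * m * Im z - u z)\<close> with a positive harmonic function \<open>u\<close>, and
  \<open>u\<close> is bounded on a horizontal line because \<open>f\<close> is bounded away from \<open>0\<close> there. Harnack's inequality
  makes the vertical growth rate of a positive harmonic function equal to the infimum of its
  quotient by \<open>Im z\<close>. Maximality of \<open>m\<close> makes this infimum \<open>0\<close> for \<open>u\<close>, and the same
  principle applied to the difference of a linear bound and \<open>u\<close> then bounds \<open>u\<close>. Hence \<open>f z * e(- m * z)\<close> stays away from \<open>0\<close>
  as \<open>Im z\<close> tends to infinity, while it tends to the coefficient at the frequency \<open>m\<close>.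

  Estimates for \<open>f\<close> are uniform under real translations, by compactness (\<open>hull_compact\<close>): a sequence
  of translates of \<open>f\<close> has a subsequence that converges uniformly on every horizontal strip, and
  the limit is not identically zero (\<open>hull_nonzero\<close>). With Hurwitz's theorem this gives the lower
  bound on horizontal lines, and it gives vertical segments in every unit interval on which \<open>f\<close> is
  bounded away from \<open>0\<close> (\<open>good_verticals\<close>). These serve as the short sides of the rectangles, and they also
  bound the number of zeros in a unit interval, so the measure is tempered.
\<close>

section \<open>Absolutely convergent exponential sums\<close>

definition wave :: "real \<Rightarrow> complex \<Rightarrow> complex" where
  "wave l z = exp (2 * of_real pi * \<i> * of_real l * z)"

lemma norm_wave: "norm (wave l z) = exp (- (2 * pi * l * Im z))"
  by (simp add: wave_def)

lemma wave_nonzero [simp]: "wave l z \<noteq> 0"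
  by (simp add: wave_def)

lemma wave_zero [simp]: "wave 0 z = 1"
  by (simp add: wave_def)

lemma wave_add_freq: "wave (l + m) z = wave l z * wave m z"
  by (simp add: wave_def algebra_simps flip: exp_add)

lemma wave_add: "wave l (z + w) = wave l z * wave l w"
  by (simp add: wave_def algebra_simps flip: exp_add)

lemma wave_deriv: "(wave l has_field_derivative 2 * of_real pi * \<i> * of_real l * wave l z) (at z)"
  unfolding wave_def by (auto intro!: derivative_eq_intros)

lemma wave_holomorphic [holomorphic_intros]: "wave l holomorphic_on S"
  unfolding wave_def by (intro holomorphic_intros)

lemma continuous_on_wave [continuous_intros]: "continuous_on S g \<Longrightarrow> continuous_on S (\<lambda>x. wave l (g x))"
  unfolding wave_def by (intro continuous_intros)

lemma norm_wave_le:
  assumes "\<bar>l\<bar> \<le> W" "\<bar>Im z\<bar> \<le> Y"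
  shows "norm (wave l z) \<le> exp (2 * pi * W * Y)"
proof -
  have "\<bar>l * Im z\<bar> \<le> W * Y" using assms by (simp add: abs_mult mult_mono')
  then have "- (l * Im z) \<le> W * Y" by linarith
  then have "2 * pi * - (l * Im z) \<le> 2 * pi * (W * Y)"
    by (intro mult_left_mono) auto
  then show ?thesis by (simp add: norm_wave mult.assoc)
qed

text \<open>Tannery's theorem, in the form in which it replaces dominated convergence below.\<close>

lemma suminf_tendsto:
  fixes a :: "nat \<Rightarrow> 'b \<Rightarrow> 'a :: {real_normed_algebra, banach}"
  assumes "\<And>k. ((\<lambda>n. a k n) \<longlongrightarrow> b k) F"
    and "eventually (\<lambda>n. \<forall>k. norm (a k n) \<le> M k) F"
    and "summable M" "F \<noteq> bot"
  shows "((\<lambda>n. \<Sum>k. a k n) \<longlongrightarrow> (\<Sum>k. b k)) F"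
proof -
  have "eventually (\<lambda>(k,n). norm (a k n) \<le> M k) (at_top \<times>\<^sub>F F)"
    unfolding eventually_prod_filter case_prod_unfold
    by (rule exI[of _ "\<lambda>_. True"], rule exI[of _ "\<lambda>n. \<forall>k. norm (a k n) \<le> M k"]) (use assms(2) in auto)
  from tannerys_theorem[OF assms(1) this assms(3,4)] show ?thesis by blast
qed

definition expsum :: "(nat \<Rightarrow> complex) \<Rightarrow> (nat \<Rightarrow> real) \<Rightarrow> complex \<Rightarrow> complex" where
  "expsum q w z = (\<Sum>n. q n * wave (w n) z)"

locale exponential_sum =
  fixes q :: "nat \<Rightarrow> complex" and w :: "nat \<Rightarrow> real" and W :: real
  assumes coeffs: "summable (\<lambda>n. norm (q n))"
    and freqs: "\<And>n. \<bar>w n\<bar> \<le> W"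
begin

abbreviation "Q \<equiv> (\<Sum>n. norm (q n))"
abbreviation "f \<equiv> expsum q w"

lemma Q_nonneg: "0 \<le> Q" by (intro suminf_nonneg coeffs) auto

lemma norm_term_le:
  assumes "\<bar>Im z\<bar> \<le> Y"
  shows "norm (q n * wave (w n) z) \<le> norm (q n) * exp (2 * pi * W * Y)"
  using norm_wave_le[OF freqs assms] by (simp add: norm_mult mult_left_mono)

lemma summable_norm_terms: "summable (\<lambda>n. norm (q n * wave (w n) z))"
  by (rule summable_comparison_test'[OF summable_mult2[OF coeffs, of "exp (2 * pi * W * \<bar>Im z\<bar>)"]])
     (use norm_term_le[OF order_refl] in auto)

lemma summable_terms: "summable (\<lambda>n. q n * wave (w n) z)"
  by (rule summable_norm_cancel[OF summable_norm_terms])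

lemma expsum_sums: "(\<lambda>n. q n * wave (w n) z) sums f z"
  unfolding expsum_def by (rule summable_sums[OF summable_terms])

lemma norm_expsum_le:
  assumes "\<bar>Im z\<bar> \<le> Y"
  shows "norm (f z) \<le> Q * exp (2 * pi * W * Y)"
proof -
  have "norm (f z) \<le> (\<Sum>n. norm (q n * wave (w n) z))"
    unfolding expsum_def by (rule summable_norm[OF summable_norm_terms])
  also have "\<dots> \<le> (\<Sum>n. norm (q n) * exp (2 * pi * W * Y))"
    by (intro suminf_le norm_term_le assms summable_norm_terms summable_mult2 coeffs)
  finally show ?thesis by (simp add: suminf_mult2[OF coeffs])
qed

lemma derivative_series: "exponential_sum (\<lambda>n. 2 * of_real pi * \<i> * of_real (w n) * q n) w W"
proof
  show "summable (\<lambda>n. norm (2 * of_real pi * \<i> * of_real (w n) * q n))"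
    by (rule summable_comparison_test'[OF summable_mult[OF coeffs, of "2 * pi * W"]])
       (use freqs in \<open>auto simp: norm_mult intro!: mult_right_mono\<close>)
qed (rule freqs)

lemma expsum_deriv:
  "(f has_field_derivative expsum (\<lambda>n. 2 * of_real pi * \<i> * of_real (w n) * q n) w z) (at z)"
proof -
  let ?q' = "\<lambda>n. 2 * of_real pi * \<i> * of_real (w n) * q n"
  interpret D: exponential_sum ?q' w W by (rule derivative_series)
  have "\<exists>g g'. \<forall>x\<in>UNIV. (\<lambda>n. q n * wave (w n) x) sums g x \<and> (\<lambda>n. ?q' n * wave (w n) x) sums g' x \<and>
          (g has_field_derivative g' x) (at x)"
  proof (rule series_and_derivative_comparison_complex)
    fix n and x :: complex
    show "((\<lambda>x. q n * wave (w n) x) has_field_derivative ?q' n * wave (w n) x) (at x)"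
      by (auto intro!: derivative_eq_intros wave_deriv)
  next
    fix x :: complex
    let ?h = "\<lambda>n. complex_of_real (norm (q n) * exp (2 * pi * W * (\<bar>Im x\<bar> + 1)))"
    have "summable ?h"
      by (rule summable_of_real) (rule summable_mult2[OF coeffs])
    moreover have "\<bar>Im y\<bar> \<le> \<bar>Im x\<bar> + 1" if "y \<in> ball x 1" for y
      using that abs_Im_le_cmod[of "y - x"] by (simp add: dist_norm norm_minus_commute)
    then have "cmod (q n * wave (w n) y) \<le> cmod (?h n)" if "y \<in> ball x 1" for y n
      using norm_term_le[of y "\<bar>Im x\<bar> + 1" n] that by (simp add: norm_mult)
    ultimately show "\<exists>d h. 0 < d \<and> summable h \<and> range h \<subseteq> \<real>\<^sub>\<ge>\<^sub>0 \<and>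
       (\<forall>\<^sub>F n in sequentially. \<forall>y\<in>ball x d \<inter> UNIV. cmod (q n * wave (w n) y) \<le> cmod (h n))"
      by (intro exI[of _ 1] exI[of _ ?h]) (auto intro!: always_eventually)
  qed auto
  then obtain g g' where g: "\<And>x. (\<lambda>n. q n * wave (w n) x) sums g x"
      "\<And>x. (\<lambda>n. ?q' n * wave (w n) x) sums g' x" "\<And>x. (g has_field_derivative g' x) (at x)"
    by blast
  have "g = f" using g(1) expsum_sums sums_unique2 by blast
  moreover have "g' = expsum ?q' w" using g(2) D.expsum_sums sums_unique2 by blast
  ultimately show ?thesis using g(3) by metis
qed

lemma expsum_holomorphic: "f holomorphic_on S"
  using expsum_deriv by (meson holomorphic_onI field_differentiable_at_within field_differentiable_def)

lemma deriv_expsum: "deriv f = expsum (\<lambda>n. 2 * of_real pi * \<i> * of_real (w n) * q n) w"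
  using expsum_deriv DERIV_imp_deriv by blast

text \<open>The translate by \<open>x\<close> has the coefficients \<open>q n * e(w n * x)\<close>, points of circles of fixed
  radius. A diagonal sequence makes all of them converge, and summability of \<open>\<bar>q n\<bar>\<close> turns
  this into uniform convergence of the functions.\<close>

lemma hull_compact:
  fixes x :: "nat \<Rightarrow> real"
  obtains r :: "nat \<Rightarrow> nat" and h where "strict_mono r" "h holomorphic_on UNIV"
    "\<And>Y. uniform_limit {z. \<bar>Im z\<bar> \<le> Y} (\<lambda>j z. f (z + of_real (x (r j)))) h sequentially"
proof -
  have "norm (wave (w n) (of_real (x j))) \<le> 1" for n j by (simp add: norm_wave)
  then obtain r :: "nat \<Rightarrow> nat" where r: "strict_mono r"
      "\<And>n. n \<in> UNIV \<Longrightarrow> \<exists>l. (\<lambda>j. wave (w n) (of_real (x (r j)))) \<longlonglongrightarrow> l"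
    using function_convergent_subsequence[of "UNIV :: nat set" "\<lambda>j n. wave (w n) (of_real (x j))" 1]
    by (metis countableI_type)
  then obtain t where t: "\<And>n. (\<lambda>j. wave (w n) (of_real (x (r j)))) \<longlonglongrightarrow> t n"
    by (metis UNIV_I)
  have t1: "norm (t n) = 1" for n
    using tendsto_unique[OF _ tendsto_norm[OF t[of n]], of 1] by (simp add: norm_wave)
  interpret h: exponential_sum "\<lambda>n. q n * t n" w W
    by standard (use coeffs freqs in \<open>auto simp: norm_mult t1\<close>)
  define d where "d j = (\<Sum>n. norm (q n) * norm (wave (w n) (of_real (x (r j))) - t n))" for j
  have dle: "norm (wave (w n) (of_real (x (r j))) - t n) \<le> 2" for n j
    using norm_triangle_ineq4[of "wave (w n) (of_real (x (r j)))" "t n"] by (simp add: t1 norm_wave)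
  have dsum: "summable (\<lambda>n. norm (q n) * norm (wave (w n) (of_real (x (r j))) - t n))" for j
    by (rule summable_comparison_test'[OF summable_mult2[OF coeffs, of 2]])
       (use dle in \<open>auto intro!: mult_left_mono\<close>)
  have "d \<longlonglongrightarrow> (\<Sum>n. norm (q n) * 0)"
    unfolding d_def
  proof (rule suminf_tendsto)
    fix n
    show "(\<lambda>j. norm (q n) * norm (wave (w n) (of_real (x (r j))) - t n)) \<longlonglongrightarrow> norm (q n) * 0"
      using t[of n] by (intro tendsto_mult tendsto_const tendsto_norm_zero) (simp add: LIM_zero)
  next
    show "\<forall>\<^sub>F j in sequentially. \<forall>n. norm (norm (q n) * norm (wave (w n) (of_real (x (r j))) - t n)) \<le> norm (q n) * 2"
      using dle by (intro always_eventually allI) (auto intro!: mult_left_mono)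
  qed (use summable_mult2[OF coeffs, of 2] in auto)
  then have d0: "d \<longlonglongrightarrow> 0" by simp
  have est: "norm (f (z + of_real (x (r j))) - expsum (\<lambda>n. q n * t n) w z) \<le> d j * exp (2 * pi * W * Y)"
    if "\<bar>Im z\<bar> \<le> Y" for z j Y
  proof -
    have s: "(\<lambda>n. q n * (wave (w n) (of_real (x (r j))) - t n) * wave (w n) z) sums
          (f (z + of_real (x (r j))) - expsum (\<lambda>n. q n * t n) w z)"
      using sums_diff[OF expsum_sums[of "z + of_real (x (r j))"] h.expsum_sums[of z]]
      by (simp add: wave_add algebra_simps)
    have le: "norm (q n * (wave (w n) (of_real (x (r j))) - t n) * wave (w n) z)
        \<le> norm (q n) * norm (wave (w n) (of_real (x (r j))) - t n) * exp (2 * pi * W * Y)" for n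
      unfolding norm_mult using norm_wave_le[OF freqs that] by (intro mult_left_mono) auto
    have "norm (f (z + of_real (x (r j))) - expsum (\<lambda>n. q n * t n) w z)
        \<le> (\<Sum>n. norm (q n) * norm (wave (w n) (of_real (x (r j))) - t n) * exp (2 * pi * W * Y))"
      unfolding sums_unique[OF s] by (rule norm_suminf_le[OF le summable_mult2[OF dsum]])
    then show ?thesis by (simp add: d_def suminf_mult2[OF dsum])
  qed
  have "uniform_limit {z. \<bar>Im z\<bar> \<le> Y} (\<lambda>j z. f (z + of_real (x (r j)))) (expsum (\<lambda>n. q n * t n) w) sequentially" for Y
  proof (rule uniform_limitI)
    fix e :: real assume "e > 0"
    have "(\<lambda>j. d j * exp (2 * pi * W * Y)) \<longlonglongrightarrow> 0 * exp (2 * pi * W * Y)"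
      by (intro tendsto_intros d0)
    then have "\<forall>\<^sub>F j in sequentially. d j * exp (2 * pi * W * Y) < e"
      by (rule order_tendstoD(2)) (use \<open>e > 0\<close> in simp)
    then show "\<forall>\<^sub>F j in sequentially. \<forall>z\<in>{z. \<bar>Im z\<bar> \<le> Y}.
        dist (f (z + of_real (x (r j)))) (expsum (\<lambda>n. q n * t n) w z) < e"
    proof eventually_elim
      case (elim j)
      show ?case using est[of _ Y j] elim by (auto simp: dist_norm intro: le_less_trans)
    qed
  qed
  then show ?thesis using that r(1) h.expsum_holomorphic by blast
qed

text \<open>Uniformity on a whole strip is what matters here: it allows the limit to be
  translated back, so that \<open>h = 0\<close> on the line through \<open>z0\<close> would force \<open>f z0 = 0\<close>.\<close>

lemma hull_nonzero:
  fixes x :: "nat \<Rightarrow> real"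
  assumes lim: "\<And>Y. uniform_limit {z. \<bar>Im z\<bar> \<le> Y} (\<lambda>j z. f (z + of_real (x j))) h sequentially"
    and "f z0 \<noteq> 0"
  obtains a :: real where "h (z0 + of_real a) \<noteq> 0"
proof (rule ccontr)
  assume "\<not> thesis"
  then have 0: "h (z0 + of_real a) = 0" for a using that by blast
  have "\<forall>\<^sub>F j in sequentially. \<forall>z\<in>{z. \<bar>Im z\<bar> \<le> \<bar>Im z0\<bar>}. dist (f (z + of_real (x j))) (h z) < norm (f z0)"
    using uniform_limitD[OF lim, of "norm (f z0)"] assms(2) by simp
  then obtain j where "\<And>z. \<bar>Im z\<bar> \<le> \<bar>Im z0\<bar> \<Longrightarrow> dist (f (z + of_real (x j))) (h z) < norm (f z0)"
    by (auto simp: eventually_sequentially)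
  from this[of "z0 - of_real (x j)"] show False
    using 0[of "- x j"] by simp
qed

text \<open>If \<open>f\<close> came arbitrarily close to \<open>0\<close> on the line, some limit of translates would
  vanish at a point of it. By Hurwitz's theorem this contradicts the absence of zeros of the
  translates.\<close>

lemma lower_bound_on_line:
  assumes nz: "\<And>z. 0 < Im z \<Longrightarrow> f z \<noteq> 0" and "0 < y"
  obtains c where "0 < c" "\<And>z. Im z = y \<Longrightarrow> c \<le> norm (f z)"
proof (rule ccontr)
  assume "\<not> thesis"
  then have "\<exists>z. Im z = y \<and> norm (f z) < inverse (real (Suc j))" for j
    using that[of "inverse (real (Suc j))"] by (force simp: not_le)
  then obtain z where z: "\<And>j. Im (z j) = y" "\<And>j. norm (f (z j)) < inverse (real (Suc j))" by metis
  obtain r h where rh: "strict_mono r" "h holomorphic_on UNIV"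
    "\<And>Y. uniform_limit {z. \<bar>Im z\<bar> \<le> Y} (\<lambda>j u. f (u + of_real (Re (z (r j))))) h sequentially"
    using hull_compact[of "\<lambda>j. Re (z j)"] by blast
  let ?H = "{z. 0 < Im z}"
  have zj: "\<i> * of_real y + of_real (Re (z j)) = z j" for j
    using z(1) by (simp add: complex_eq_iff)
  have "(\<lambda>j. f (z (r j))) \<longlonglongrightarrow> h (\<i> * of_real y)"
    using tendsto_uniform_limitI[OF rh(3)[of y], of "\<i> * of_real y"] \<open>0 < y\<close> by (simp add: zj)
  moreover have "(\<lambda>j. f (z (r j))) \<longlonglongrightarrow> 0"
  proof (rule Lim_null_comparison)
    show "\<forall>\<^sub>F j in sequentially. norm (f (z (r j))) \<le> inverse (real (Suc (r j)))"
      using less_imp_le[OF z(2)] by (intro always_eventually) blast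
    show "(\<lambda>j. inverse (real (Suc (r j)))) \<longlonglongrightarrow> 0"
      using LIMSEQ_subseq_LIMSEQ[OF LIMSEQ_inverse_real_of_nat rh(1)] by (simp add: o_def)
  qed
  ultimately have h0: "h (\<i> * of_real y) = 0" using LIMSEQ_unique by blast
  obtain a where a: "h (\<i> + of_real a) \<noteq> 0"
    using hull_nonzero[OF rh(3), of \<i>] nz[of \<i>] by auto
  have "h (\<i> * of_real y) \<noteq> 0"
  proof (rule Hurwitz_no_zeros[of ?H "\<lambda>j u. f (u + of_real (Re (z (r j))))" h])
    show "open ?H" by (rule open_halfspace_Im_gt)
    show "connected ?H" by (intro convex_connected convex_halfspace_Im_gt)
    show "(\<lambda>u. f (u + of_real (Re (z (r j))))) holomorphic_on ?H" for j
      by (intro holomorphic_on_compose_gen[OF _ expsum_holomorphic, unfolded o_def] holomorphic_intros) auto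
    show "h holomorphic_on ?H" using rh(2) by (rule holomorphic_on_subset) auto
    show "uniform_limit K (\<lambda>j u. f (u + of_real (Re (z (r j))))) h sequentially" if K: "compact K" "K \<subseteq> ?H" for K
    proof -
      obtain B where B: "\<And>u. u \<in> K \<Longrightarrow> norm u \<le> B" using compact_imp_bounded[OF K(1)] by (auto simp: bounded_iff)
      have "K \<subseteq> {z. \<bar>Im z\<bar> \<le> B}" using B abs_Im_le_cmod by (blast intro: order_trans)
      then show ?thesis using rh(3) uniform_limit_on_subset by blast
    qed
    show "\<not> h constant_on ?H"
    proof
      assume "h constant_on ?H"
      then have "h (\<i> * of_real y) = h (\<i> + of_real a)" using \<open>0 < y\<close> unfolding constant_on_def by force
      with h0 a show False by simp
    qed
    show "f (u + of_real (Re (z (r j)))) \<noteq> 0" if "u \<in> ?H" for j u using nz that by simp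
    show "\<i> * of_real y \<in> ?H" using \<open>0 < y\<close> by simp
  qed
  with h0 show False by simp
qed

text \<open>A limit of translates has finitely many zeros in a compact rectangle, so some vertical
  segment avoids them. By uniform convergence the translates are bounded away from \<open>0\<close> there.\<close>

lemma good_verticals:
  assumes "f z0 \<noteq> 0"
  obtains d where "0 < d"
    "\<And>T. \<exists>T'\<in>{T..T+1}. \<forall>y\<in>{-s..s}. d \<le> norm (f (Complex T' y))"
proof (rule ccontr)
  assume "\<not> thesis"
  then have "\<exists>T. \<forall>T'\<in>{T..T+1}. \<exists>y\<in>{-s..s}. norm (f (Complex T' y)) < inverse (real (Suc j))" for j
    using that[of "inverse (real (Suc j))"] by (force simp: not_le)
  then obtain T where T: "\<And>j T'. T' \<in> {T j..T j+1} \<Longrightarrow> \<exists>y\<in>{-s..s}. norm (f (Complex T' y)) < inverse (real (Suc j))"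
    by metis
  obtain r h where rh: "strict_mono r" "h holomorphic_on UNIV"
    "\<And>Y. uniform_limit {z. \<bar>Im z\<bar> \<le> Y} (\<lambda>j u. f (u + of_real (T (r j)))) h sequentially"
    using hull_compact[of T] by blast
  obtain a where a: "h (z0 + of_real a) \<noteq> 0" using hull_nonzero[OF rh(3) assms] by blast
  let ?K = "cbox (Complex 0 (-s)) (Complex 1 s)"
  have "finite {z \<in> ?K. h z = 0}"
  proof (cases "h constant_on UNIV")
    case True
    then have "h z \<noteq> 0" for z using a by (metis UNIV_I constant_on_def)
    then show ?thesis by simp
  next
    case False
    then show ?thesis
      by (intro holomorphic_compact_finite_zeros[OF rh(2)]) auto
  qed
  then have "finite (Re ` {z \<in> ?K. h z = 0})" by blast
  moreover have "infinite {0..1::real}" by simp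
  ultimately obtain b where b: "b \<in> {0..1}" "b \<notin> Re ` {z \<in> ?K. h z = 0}"
    by (meson infinite_super subsetI)
  have hb: "h (Complex b y) \<noteq> 0" if "y \<in> {-s..s}" for y
    using b that by (force simp: in_cbox_complex_iff image_iff)
  have "continuous_on {-s..s} (\<lambda>y. norm (h (Complex b y)))"
  proof -
    have "continuous_on UNIV h" using rh(2) by (rule holomorphic_on_imp_continuous_on)
    then show ?thesis
      unfolding Complex_eq
      by (intro continuous_on_norm continuous_on_compose2[of UNIV h "{-s..s}" "\<lambda>y. of_real b + \<i> * of_real y"] continuous_intros) auto
  qed
  obtain m where m: "0 < m" "\<And>y. y \<in> {-s..s} \<Longrightarrow> m \<le> norm (h (Complex b y))"
  proof (cases "{-s..s} = {}")
    case True
    then show ?thesis using that[of 1] by auto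
  next
    case False
    from continuous_attains_inf[OF compact_Icc False \<open>continuous_on {-s..s} (\<lambda>y. norm (h (Complex b y)))\<close>]
    show ?thesis using that hb by (metis zero_less_norm_iff)
  qed
  have "\<forall>\<^sub>F j in sequentially. \<forall>z\<in>{z. \<bar>Im z\<bar> \<le> s}. dist (f (z + of_real (T (r j)))) (h z) < m / 2"
    by (rule uniform_limitD[OF rh(3)]) (use m(1) in simp)
  moreover have "\<forall>\<^sub>F j in sequentially. inverse (real (Suc (r j))) < m / 2"
    using LIMSEQ_subseq_LIMSEQ[OF LIMSEQ_inverse_real_of_nat rh(1)] m(1)
    by (auto simp: o_def dest: order_tendstoD(2)[of _ _ _ "m/2"])
  ultimately have "\<forall>\<^sub>F j in sequentially. False"
  proof eventually_elim
    case (elim j)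
    obtain y where y: "y \<in> {-s..s}" "norm (f (Complex (b + T (r j)) y)) < inverse (real (Suc (r j)))"
      using T[of "b + T (r j)" "r j"] b by auto
    have "Complex b y + of_real (T (r j)) = Complex (b + T (r j)) y" by (simp add: complex_eq_iff)
    then have "norm (f (Complex (b + T (r j)) y) - h (Complex b y)) < m / 2"
      using bspec[OF elim(1), of "Complex b y"] y(1) by (simp add: dist_norm abs_le_iff)
    then show False
      using m(2)[OF y(1)] y(2) elim(2) norm_triangle_ineq3[of "f (Complex (b + T (r j)) y)" "h (Complex b y)"] by linarith
  qed
  then show False by simp
qed

end

section \<open>The lowest frequency of a zero-free sum\<close>

text \<open>The Schwarz lemma for the map from the half-plane to the right half-plane, after Cayley
  transforms on both sides that send \<open>a\<close> and \<open>g a\<close> to \<open>0\<close>. The constant in terms of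
  \<open>cmod (z - cnj a)\<close> is four over one minus the squared pseudo-hyperbolic distance of \<open>z\<close> and \<open>a\<close>.\<close>

lemma harnack_upper_halfplane:
  assumes hol: "g holomorphic_on {z. 0 < Im z}" and pos: "\<And>z. 0 < Im z \<Longrightarrow> 0 < Re (g z)"
    and z: "0 < Im z" and a: "0 < Im a"
  shows "Re (g z) \<le> Re (g a) * (norm (z - cnj a))\<^sup>2 / (Im z * Im a)"
proof -
  define C where "C w = (a - cnj a * w) / (1 - w)" for w
  define F where "F w = (g (C w) - g a) / (g (C w) + cnj (g a))" for w
  define \<xi> where "\<xi> = (z - a) / (z - cnj a)"
  have w1: "w \<noteq> 1" if "norm w < 1" for w :: complex using that by auto
  have CH: "0 < Im (C w)" if "norm w < 1" for w
  proof -
    have "Im ((a - cnj a * w) * cnj (1 - w)) = Im a * (1 - (norm w)\<^sup>2)"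
      unfolding cmod_power2 by (simp add: algebra_simps power2_eq_square)
    moreover have "(norm w)\<^sup>2 < 1" using that by (simp add: abs_square_less_1)
    ultimately show ?thesis using a unfolding C_def by (simp only: Im_complex_div_gt_0) simp
  qed
  have C_hol: "C holomorphic_on ball 0 1"
    unfolding C_def by (intro holomorphic_intros) auto
  have den: "g (C w) + cnj (g a) \<noteq> 0" if "norm w < 1" for w
  proof -
    have "0 < Re (g (C w) + cnj (g a))" using pos[OF CH[OF that]] pos[OF a] by simp
    then show ?thesis by (metis less_irrefl zero_complex.sel(1))
  qed
  \<comment> \<open>polarisation: it converts the Schwarz bound into a bound for real parts\<close>
  have key: "(norm (G + cnj A))\<^sup>2 - (norm (G - A))\<^sup>2 = 4 * Re G * Re A" for G A :: complex
    unfolding cmod_power2 by (simp add: algebra_simps power2_eq_square)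
  have "(g \<circ> C) holomorphic_on ball 0 1"
    by (rule holomorphic_on_compose_gen[OF C_hol hol]) (use CH in auto)
  then have F_hol: "F holomorphic_on ball 0 1"
    unfolding F_def by (intro holomorphic_intros) (use den in \<open>auto simp: o_def\<close>)
  have F_lt: "norm (F w) < 1" if "norm w < 1" for w
  proof -
    have "0 < 4 * Re (g (C w)) * Re (g a)" using pos[OF CH[OF that]] pos[OF a] by simp
    then have "(norm (g (C w) - g a))\<^sup>2 < (norm (g (C w) + cnj (g a)))\<^sup>2" using key[of "g (C w)" "g a"] by linarith
    then have "norm (g (C w) - g a) < norm (g (C w) + cnj (g a))" by (rule power2_less_imp_less) simp
    then show ?thesis using den[OF that] by (simp add: F_def norm_divide divide_less_eq_1)
  qed
  have "0 < Im (z - cnj a)" using z a by simp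
  then have dz: "z - cnj a \<noteq> 0" by (metis less_irrefl zero_complex.sel(2))
  have k2: "(norm (z - cnj a))\<^sup>2 - (norm (z - a))\<^sup>2 = 4 * Im z * Im a"
    unfolding cmod_power2 by (simp add: algebra_simps power2_eq_square)
  have "0 < 4 * Im z * Im a" using z a by simp
  then have "(norm (z - a))\<^sup>2 < (norm (z - cnj a))\<^sup>2" using k2 by linarith
  then have "norm (z - a) < norm (z - cnj a)" by (rule power2_less_imp_less) simp
  then have \<xi>1: "norm \<xi> < 1" using dz by (simp add: \<xi>_def norm_divide divide_less_eq_1)
  have am: "a - cnj a \<noteq> 0" using a by (auto simp: complex_eq_iff)
  have "1 - \<xi> = (a - cnj a) / (z - cnj a)" "a - cnj a * \<xi> = z * (a - cnj a) / (z - cnj a)"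
    using dz by (simp_all add: \<xi>_def field_simps)
  then have C\<xi>: "C \<xi> = z" using dz am by (simp add: C_def)
  have F0: "F 0 = 0" by (simp add: F_def C_def)
  have "norm (F \<xi>) \<le> norm \<xi>" by (rule Schwarz_Lemma(1)[OF F_hol F0 F_lt \<xi>1])
  then have le: "norm (g z - g a) \<le> norm \<xi> * norm (g z + cnj (g a))"
    using den[OF \<xi>1] by (simp add: F_def C\<xi> norm_divide divide_le_eq)
  let ?P = "norm (g z + cnj (g a))"
  have Gp: "0 < Re (g z)" "0 < Re (g a)" using pos z a by auto
  have "(norm (g z - g a))\<^sup>2 \<le> (norm \<xi>)\<^sup>2 * ?P\<^sup>2"
    using power_mono[OF le, of 2] by (simp add: power_mult_distrib)
  then have "(1 - (norm \<xi>)\<^sup>2) * ?P\<^sup>2 \<le> 4 * Re (g z) * Re (g a)"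
    using key[of "g z" "g a"] by (simp add: algebra_simps)
  moreover have "1 - (norm \<xi>)\<^sup>2 = 4 * Im z * Im a / (norm (z - cnj a))\<^sup>2"
    using dz unfolding k2[symmetric] \<xi>_def norm_divide power_divide by (simp add: diff_divide_distrib)
  moreover have "Re (g z) ^ 2 \<le> ?P\<^sup>2"
    using complex_Re_le_cmod[of "g z + cnj (g a)"] Gp by (intro power_mono) auto
  ultimately have "4 * Im z * Im a / (norm (z - cnj a))\<^sup>2 * Re (g z) ^ 2 \<le> 4 * Re (g z) * Re (g a)"
    using \<open>0 < 4 * Im z * Im a\<close>
    by (smt (verit) divide_nonneg_nonneg mult_left_mono zero_le_power2)
  then show ?thesis
    using Gp z a dz by (simp add: field_simps power2_eq_square)
qed

text \<open>Along the imaginary axis Harnack's bound divided by \<open>t\<close> tends to \<open>Re (g a) / Im a\<close>, for every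
  base point \<open>a\<close>. Hence the growth rate along the axis is at most the infimum of \<open>Re g / Im\<close>.\<close>

lemma harnack_growth_rate:
  assumes hol: "g holomorphic_on {z. 0 < Im z}" and pos: "\<And>z. 0 < Im z \<Longrightarrow> 0 < Re (g z)"
    and a: "0 < Im a" and less: "Re (g a) / Im a < e"
  shows "\<forall>\<^sub>F t in at_top. Re (g (\<i> * of_real t)) / t < e"
proof -
  have "((\<lambda>t. ((Re a)\<^sup>2 + (t + Im a)\<^sup>2) / t\<^sup>2) \<longlongrightarrow> 1) at_top"
    by real_asymp
  then have "((\<lambda>t. Re (g a) / Im a * (((Re a)\<^sup>2 + (t + Im a)\<^sup>2) / t\<^sup>2)) \<longlongrightarrow> Re (g a) / Im a * 1) at_top"
    by (intro tendsto_intros)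
  then have "\<forall>\<^sub>F t in at_top. Re (g a) / Im a * (((Re a)\<^sup>2 + (t + Im a)\<^sup>2) / t\<^sup>2) < e"
    using less by (auto dest: order_tendstoD)
  with eventually_gt_at_top[of 0] show ?thesis
  proof eventually_elim
    case (elim t)
    have "Re (g (\<i> * of_real t)) \<le> Re (g a) * (norm (\<i> * of_real t - cnj a))\<^sup>2 / (t * Im a)"
      using harnack_upper_halfplane[OF hol pos, of "\<i> * of_real t" a] elim a by simp
    also have "(norm (\<i> * of_real t - cnj a))\<^sup>2 = (Re a)\<^sup>2 + (t + Im a)\<^sup>2"
      by (simp add: cmod_power2)
    finally have "Re (g (\<i> * of_real t)) / t \<le> Re (g a) * ((Re a)\<^sup>2 + (t + Im a)\<^sup>2) / (t * Im a) / t"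
      using elim by (intro divide_right_mono) auto
    also have "\<dots> = Re (g a) / Im a * (((Re a)\<^sup>2 + (t + Im a)\<^sup>2) / t\<^sup>2)"
      by (simp add: power2_eq_square)
    finally show ?case using elim by linarith
  qed
qed

context exponential_sum
begin

text \<open>Only the waves with nonzero coefficient count, so a one-sided bound on the frequencies of a
  restricted sum gives a one-sided exponential bound.\<close>

lemma norm_expsum_le_support:
  assumes "\<And>n. q n \<noteq> 0 \<Longrightarrow> norm (wave (w n) z) \<le> B"
  shows "norm (f z) \<le> Q * B"
proof -
  have "norm (q n * wave (w n) z) \<le> norm (q n) * B" for n
    using assms[of n] by (cases "q n = 0") (auto simp: norm_mult intro: mult_left_mono)
  then show ?thesis
    unfolding expsum_def suminf_mult2[OF coeffs]
    by (intro norm_suminf_le summable_mult2 coeffs)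
qed

lemma restrict: "exponential_sum (\<lambda>n. if P n then q n else 0) w W"
  by standard (auto intro!: freqs summable_comparison_test'[OF coeffs])

lemma restrict_norm_le: "(\<Sum>n. norm (if P n then q n else 0)) \<le> Q"
  by (intro suminf_le coeffs exponential_sum.coeffs[OF restrict]) auto

lemma expsum_split:
  "f z = expsum (\<lambda>n. if P n then q n else 0) w z + expsum (\<lambda>n. if \<not> P n then q n else 0) w z"
proof -
  interpret L: exponential_sum "\<lambda>n. if P n then q n else 0" w W by (rule restrict)
  interpret U: exponential_sum "\<lambda>n. if \<not> P n then q n else 0" w W by (rule restrict)
  have "(\<lambda>n. q n * wave (w n) z) sums
      (expsum (\<lambda>n. if P n then q n else 0) w z + expsum (\<lambda>n. if \<not> P n then q n else 0) w z)"
    by (rule sums_cong[THEN iffD1, OF _ sums_add[OF L.expsum_sums[of z] U.expsum_sums[of z]]]) auto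
  then show ?thesis using expsum_sums sums_unique2 by blast
qed

text \<open>The low part of \<open>f\<close>, multiplied by \<open>e(- m * z)\<close>, is bounded in the lower half-plane because its
  frequencies are below \<open>m\<close>, and in the upper one because both \<open>f\<close> and its high part decay fast enough. By
  Liouville it is constant, and it tends to \<open>0\<close> downwards.\<close>

lemma low_frequencies_vanish:
  assumes decay: "\<And>z. 0 < Im z \<Longrightarrow> norm (f z) \<le> C * exp (- (2 * pi * m * Im z))"
  shows "expsum (\<lambda>n. if w n < m then q n else 0) w z = 0"
proof -
  let ?L = "\<lambda>n. if w n < m then q n else 0" and ?U = "\<lambda>n. if \<not> w n < m then q n else 0"
  interpret L: exponential_sum ?L w W by (rule restrict)
  interpret U: exponential_sum ?U w W by (rule restrict)
  define G where "G z = L.f z * wave (- m) z" for z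
  have mono: "exp (- (2 * pi * a * y)) \<le> exp (- (2 * pi * b * y))" if "b * y \<le> a * y" for a b y :: real
    using mult_left_mono[OF that, of "2 * pi"] by (simp add: mult.assoc)
  have Gle: "norm (G z) \<le> \<bar>C\<bar> + Q" for z
  proof (cases "0 < Im z")
    case True
    have "norm (U.f z) \<le> U.Q * exp (- (2 * pi * m * Im z))"
      by (rule U.norm_expsum_le_support) (use True in \<open>auto simp: norm_wave split: if_splits intro!: mult_left_mono\<close>)
    also have "\<dots> \<le> Q * exp (- (2 * pi * m * Im z))" by (intro mult_right_mono restrict_norm_le) auto
    finally have "norm (L.f z) \<le> C * exp (- (2 * pi * m * Im z)) + Q * exp (- (2 * pi * m * Im z))"
      using decay[OF True] norm_triangle_ineq4[of "f z" "U.f z"] expsum_split[of z "\<lambda>n. w n < m"] by simp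
    then have "norm (L.f z) * exp (2 * pi * m * Im z) \<le>
        (C + Q) * exp (- (2 * pi * m * Im z)) * exp (2 * pi * m * Im z)"
      by (intro mult_right_mono) (auto simp: algebra_simps)
    then show ?thesis by (simp add: G_def norm_mult norm_wave mult.assoc flip: exp_add)
  next
    case False
    have "norm (L.f z) \<le> L.Q * exp (- (2 * pi * m * Im z))"
      using False
      by (intro L.norm_expsum_le_support) (auto simp: norm_wave split: if_splits intro!: mono mult_right_mono_neg)
    also have "\<dots> \<le> Q * exp (- (2 * pi * m * Im z))" by (intro mult_right_mono restrict_norm_le) auto
    finally have "norm (L.f z) * exp (2 * pi * m * Im z) \<le>
        Q * exp (- (2 * pi * m * Im z)) * exp (2 * pi * m * Im z)"
      by (intro mult_right_mono) (auto simp: algebra_simps)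
    then show ?thesis by (simp add: G_def norm_mult norm_wave mult.assoc flip: exp_add)
  qed
  have "G constant_on UNIV"
  proof (rule Liouville_theorem)
    show "G holomorphic_on UNIV" unfolding G_def by (intro holomorphic_intros L.expsum_holomorphic)
    show "bounded (range G)" using Gle by (auto simp: bounded_iff)
  qed
  then obtain c where c: "\<And>z. G z = c" by (auto simp: constant_on_def)
  have "((\<lambda>t. \<Sum>n. ?L n * wave (w n - m) (- (\<i> * of_real t))) \<longlongrightarrow> (\<Sum>n. 0)) (at_top :: real filter)"
  proof (rule suminf_tendsto)
    fix n
    show "((\<lambda>t. ?L n * wave (w n - m) (- (\<i> * of_real t))) \<longlongrightarrow> 0) (at_top :: real filter)"
    proof (cases "w n < m")
      case True
      have "((\<lambda>t::real. norm (q n) * exp (- (2 * pi * (m - w n) * t))) \<longlongrightarrow> 0) at_top"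
        using True by real_asymp
      then show ?thesis
        by (rule Lim_null_comparison[rotated]) (use True in \<open>auto simp: norm_mult norm_wave algebra_simps\<close>)
    qed simp
  next
    show "\<forall>\<^sub>F t::real in at_top. \<forall>n. norm (?L n * wave (w n - m) (- (\<i> * of_real t))) \<le> norm (q n)"
      using eventually_ge_at_top[of 0]
    proof eventually_elim
      case (elim t)
      show ?case
      proof
        fix n
        show "norm (?L n * wave (w n - m) (- (\<i> * of_real t))) \<le> norm (q n)"
          using elim
          by (auto simp: norm_mult norm_wave mult.assoc zero_le_mult_iff intro!: mult_right_le_one_le mult_nonpos_nonneg mult_nonneg_nonpos)
      qed
    qed
  qed (auto intro: coeffs)
  moreover have "(\<Sum>n. ?L n * wave (w n - m) u) = G u" for u
  proof -
    have "(\<lambda>n. ?L n * wave (w n) u * wave (- m) u) sums G u"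
      unfolding G_def by (intro sums_mult2 L.expsum_sums)
    then have "(\<lambda>n. ?L n * wave (w n - m) u) sums G u"
      using wave_add_freq[of "w _" "- m" u] by (simp add: mult.assoc)
    then show ?thesis by (simp add: sums_iff)
  qed
  ultimately have "((\<lambda>t::real. c) \<longlongrightarrow> 0) at_top" by (simp add: c)
  then have "c = 0" by (simp add: tendsto_const_iff)
  then show ?thesis using c[of z] by (simp add: G_def)
qed

text \<open>A decay estimate with some constant \<open>C\<close> improves itself to the constant \<open>Q\<close>. With this fixed
  constant the set of decay rates is closed.\<close>

lemma decay_of_high_frequencies:
  assumes decay: "\<And>z. 0 < Im z \<Longrightarrow> norm (f z) \<le> C * exp (- (2 * pi * m * Im z))" and "0 < Im z"
  shows "norm (f z) \<le> Q * exp (- (2 * pi * m * Im z))"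
proof -
  let ?U = "\<lambda>n. if \<not> w n < m then q n else 0"
  interpret U: exponential_sum ?U w W by (rule restrict)
  have "norm (U.f z) \<le> U.Q * exp (- (2 * pi * m * Im z))"
    by (rule U.norm_expsum_le_support) (use assms(2) in \<open>auto simp: norm_wave split: if_splits intro!: mult_left_mono\<close>)
  also have "\<dots> \<le> Q * exp (- (2 * pi * m * Im z))" by (intro mult_right_mono restrict_norm_le) auto
  finally show ?thesis
    using expsum_split[of z "\<lambda>n. w n < m"] low_frequencies_vanish[OF decay] by simp
qed

text \<open>The sum of the coefficients at frequency \<open>m\<close> is the limit of \<open>f z * e(- m * z)\<close> as \<open>z\<close> goes
  up the imaginary axis. It is nonzero because the positive harmonic function \<open>Re g\<close> with
  \<open>\<bar>f z * e(- m * z)\<bar> = 2 * Q * exp (- Re (g z))\<close> turns out to be bounded.\<close>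

theorem lowest_frequency_attained:
  assumes nz: "\<And>z. 0 < Im z \<Longrightarrow> f z \<noteq> 0"
  obtains m where "\<And>z. f z = expsum (\<lambda>n. if \<not> w n < m then q n else 0) w z"
    "(\<Sum>n. if w n = m then q n else 0) \<noteq> 0"
proof -
  let ?H = "{z. 0 < Im z}"
  define S where "S = {m. \<forall>z. 0 < Im z \<longrightarrow> norm (f z) \<le> Q * exp (- (2 * pi * m * Im z))}"
  have fi: "0 < norm (f \<i>)" using nz[of \<i>] by simp
  have "norm (f \<i>) \<le> Q * exp (2 * pi * W * 1)" by (rule norm_expsum_le) simp
  with fi have Qpos: "0 < Q" using Q_nonneg by (cases "Q = 0") auto
  have "- W \<in> S"
    unfolding S_def
  proof safe
    fix z :: complex assume "0 < Im z"
    then show "norm (f z) \<le> Q * exp (- (2 * pi * - W * Im z))"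
      using norm_expsum_le[of z "Im z"] by simp
  qed
  have bdd: "bdd_above S"
  proof (rule bdd_aboveI)
    fix m assume "m \<in> S"
    then have "norm (f \<i>) \<le> Q * exp (- (2 * pi * m * Im \<i>))" unfolding S_def by (auto dest: spec[of _ \<i>])
    then have "exp (2 * pi * m) \<le> Q / norm (f \<i>)"
      using fi by (simp add: exp_minus field_simps)
    moreover have "2 * pi * m \<le> exp (2 * pi * m)" using exp_ge_add_one_self[of "2 * pi * m"] by linarith
    ultimately have "2 * pi * m \<le> Q / norm (f \<i>)" by linarith
    then show "m \<le> Q / norm (f \<i>) / (2 * pi)" by (subst pos_le_divide_eq) (auto simp: mult.commute)
  qed
  have "closed S"
    unfolding S_def by (intro closed_Collect_all closed_Collect_imp closed_Collect_le continuous_intros) auto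
  \<comment> \<open>the best decay rate: \<open>S\<close> is closed, so the supremum is itself a
    decay rate\<close>
  define m where "m = Sup S"
  have mS: "m \<in> S" unfolding m_def
    using closed_contains_Sup[OF _ bdd \<open>closed S\<close>] \<open>- W \<in> S\<close> by blast
  have m_max: "m' \<le> m" if "m' \<in> S" for m' unfolding m_def using that bdd by (rule cSup_upper)
  have decay: "norm (f z) \<le> Q * exp (- (2 * pi * m * Im z))" if "0 < Im z" for z
    using mS that unfolding S_def by blast
  define F where "F z = f z * wave (- m) z / of_real (2 * Q)" for z
  have F_hol: "F holomorphic_on ?H" unfolding F_def
    using Qpos by (intro holomorphic_intros expsum_holomorphic) auto
  have F_nz: "F z \<noteq> 0" if "z \<in> ?H" for z unfolding F_def using nz[of z] Qpos that by simp
  have "open ?H" by (rule open_halfspace_Im_gt)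
  have "simply_connected ?H" by (intro convex_imp_simply_connected convex_halfspace_Im_gt)
  then obtain g1 where g1: "g1 holomorphic_on ?H" "\<And>z. z \<in> ?H \<Longrightarrow> F z = exp (g1 z)"
    using simply_connected_eq_holomorphic_log[OF \<open>open ?H\<close>] F_hol F_nz by metis
  define g where "g z = - g1 z" for z
  have g_hol: "g holomorphic_on ?H" unfolding g_def by (intro holomorphic_intros g1)
  have nf: "norm (f z) = 2 * Q * exp (- Re (g z)) * exp (- (2 * pi * m * Im z))" if "0 < Im z" for z
  proof -
    have "norm (f z) * exp (2 * pi * m * Im z) / (2 * Q) = exp (- Re (g z))"
      using arg_cong[OF g1(2), of z norm] that Qpos
      by (simp add: F_def g_def norm_mult norm_divide norm_wave)
    then show ?thesis using Qpos by (simp add: exp_minus field_simps)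
  qed
  have g_pos: "0 < Re (g z)" if "0 < Im z" for z
  proof -
    have "2 * exp (- Re (g z)) \<le> 1" using decay[OF that] nf[OF that] Qpos by simp
    then have "exp (- Re (g z)) < 1" using exp_gt_zero[of "- Re (g z)"] by linarith
    then show ?thesis by simp
  qed
  \<comment> \<open>otherwise \<open>f\<close> would decay faster than \<open>m\<close> allows; the
    constant \<open>Q\<close> in \<open>S\<close> costs nothing, since the part of \<open>f\<close>
    below a decay rate vanishes\<close>
  have small: "\<exists>z. 0 < Im z \<and> Re (g z) / Im z < e" if "0 < e" for e
  proof (rule ccontr)
    assume "\<not> ?thesis"
    then have "e \<le> Re (g z) / Im z" if "0 < Im z" for z
      using that by (meson not_less)
    then have ge: "e * Im z \<le> Re (g z)" if "0 < Im z" for z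
      using that by (simp add: pos_le_divide_eq)
    have "norm (f z) \<le> 2 * Q * exp (- (2 * pi * (m + e / (2 * pi)) * Im z))" if "0 < Im z" for z
    proof -
      have "exp (- Re (g z)) * exp (- (2 * pi * m * Im z)) \<le> exp (- (2 * pi * (m + e / (2 * pi)) * Im z))"
        using ge[OF that] by (simp add: algebra_simps flip: exp_add)
      then show ?thesis using nf[OF that] Qpos by (simp add: mult.assoc)
    qed
    then have "m + e / (2 * pi) \<in> S" unfolding S_def by (auto intro: decay_of_high_frequencies)
    moreover have "0 < e / (2 * pi)" using that by (intro divide_pos_pos) auto
    ultimately show False using m_max[of "m + e / (2 * pi)"] by linarith
  qed
  \<comment> \<open>Harnack: a small quotient at one point forces a small growth rate along the
    axis\<close>
  have u_lim: "((\<lambda>t. Re (g (\<i> * of_real t)) / t) \<longlongrightarrow> 0) at_top"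
  proof (rule tendstoI)
    fix e :: real assume "0 < e"
    then obtain a where a: "0 < Im a" "Re (g a) / Im a < e" using small by blast
    have "\<forall>\<^sub>F t in at_top. Re (g (\<i> * of_real t)) / t < e"
      by (rule harnack_growth_rate[OF g_hol _ a]) (rule g_pos)
    with eventually_gt_at_top[of 0]
    show "\<forall>\<^sub>F t in at_top. dist (Re (g (\<i> * of_real t)) / t) 0 < e"
    proof eventually_elim
      case (elim t)
      then have "0 < Re (g (\<i> * of_real t)) / t" using g_pos[of "\<i> * of_real t"] by simp
      then show ?case using elim by simp
    qed
  qed
  obtain c where c: "0 < c" "\<And>z. Im z = 1 \<Longrightarrow> c \<le> norm (f z)"
    using lower_bound_on_line[OF nz zero_less_one] by blast
  define M where "M = ln (2 * Q * exp (- (2 * pi * m)) / c)"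
  have u1: "Re (g z) \<le> M" if "Im z = 1" for z
  proof -
    have "c \<le> 2 * Q * exp (- Re (g z)) * exp (- (2 * pi * m))" using nf[of z] c(2)[of z] that by simp
    then have "exp (Re (g z)) \<le> 2 * Q * exp (- (2 * pi * m)) / c"
      using c(1) by (simp add: exp_minus field_simps)
    then show ?thesis unfolding M_def using c(1) Qpos by (subst ln_ge_iff) auto
  qed
  define K where "K = 4 * M"
  have "0 < M" using u1[of \<i>] g_pos[of \<i>] by simp
  \<comment> \<open>Harnack from the point of the line \<open>Im z = 1\<close> below
    \<open>z\<close>\<close>
  have lin: "Re (g z) \<le> K * Im z" if "1 \<le> Im z" for z
  proof -
    define a where "a = Complex (Re z) 1"
    have "Re (g z) \<le> Re (g a) * (norm (z - cnj a))\<^sup>2 / (Im z * Im a)"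
      by (rule harnack_upper_halfplane[OF g_hol g_pos]) (use that in \<open>auto simp: a_def\<close>)
    also have "(norm (z - cnj a))\<^sup>2 = (Im z + 1)\<^sup>2" by (simp add: a_def cmod_power2)
    also have "Re (g a) * (Im z + 1)\<^sup>2 / (Im z * Im a) \<le> M * (2 * Im z)\<^sup>2 / (Im z * 1)"
      using u1[of a] g_pos[of a] that \<open>0 < M\<close>
      by (intro frac_le mult_mono power_mono) (auto simp: a_def)
    also have "\<dots> = K * Im z" using that by (simp add: K_def power2_eq_square)
    finally show ?thesis .
  qed
  \<comment> \<open>on the half-plane above \<open>Im z = 1\<close> both \<open>Re g\<close> and the
    gap to its linear bound are positive harmonic; since \<open>Re g\<close> grows slower than
    linearly along the axis, the gap has growth rate \<open>K\<close>, hence it is at least \<open>K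
    * Im z\<close>, which leaves a constant for \<open>Re g\<close>\<close>
  define h where "h z = of_real K * (- \<i> * z) + of_real (K + 1) - g (z + \<i>)" for z
  have Re_h: "Re (h z) = K * Im z + K + 1 - Re (g (z + \<i>))" for z by (simp add: h_def)
  have h_hol: "h holomorphic_on ?H"
  proof -
    have "(\<lambda>z. g (z + \<i>)) holomorphic_on ?H"
      by (rule holomorphic_on_compose_gen[OF _ g_hol, unfolded o_def]) (auto intro!: holomorphic_intros)
    then show ?thesis unfolding h_def by (intro holomorphic_intros)
  qed
  have h_pos: "0 < Re (h z)" if "0 < Im z" for z
    using lin[of "z + \<i>"] that by (simp add: Re_h algebra_simps)
  have h_lim: "((\<lambda>t. Re (h (\<i> * of_real t)) / t) \<longlongrightarrow> K) at_top"
  proof -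
    have "filterlim (\<lambda>t::real. t + 1) at_top at_top" by real_asymp
    from filterlim_compose[OF u_lim this]
    have "((\<lambda>t. Re (g (\<i> * of_real (t + 1))) / (t + 1)) \<longlongrightarrow> 0) at_top" .
    moreover have "((\<lambda>t::real. (t + 1) / t) \<longlongrightarrow> 1) at_top" by real_asymp
    ultimately have "((\<lambda>t. Re (g (\<i> * of_real (t + 1))) / (t + 1) * ((t + 1) / t)) \<longlongrightarrow> 0 * 1) at_top"
      by (rule tendsto_mult)
    moreover have "((\<lambda>t::real. K + (K + 1) / t) \<longlongrightarrow> K) at_top" by real_asymp
    ultimately have "((\<lambda>t. K + (K + 1) / t - Re (g (\<i> * of_real (t + 1))) / (t + 1) * ((t + 1) / t)) \<longlongrightarrow> K - 0 * 1) at_top"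
      by (intro tendsto_diff)
    then have "((\<lambda>t. K + (K + 1) / t - Re (g (\<i> * of_real (t + 1))) / (t + 1) * ((t + 1) / t)) \<longlongrightarrow> K) at_top"
      by simp
    then show ?thesis
    proof (rule Lim_transform_eventually)
      show "\<forall>\<^sub>F t in at_top. K + (K + 1) / t - Re (g (\<i> * of_real (t + 1))) / (t + 1) * ((t + 1) / t) = Re (h (\<i> * of_real t)) / t"
        using eventually_gt_at_top[of 0]
      proof eventually_elim
        case (elim t)
        let ?R = "Re (g (\<i> * of_real (t + 1)))"
        have "?R / (t + 1) * ((t + 1) / t) = ?R / t" using elim by simp
        moreover have "Re (h (\<i> * of_real t)) = K * t + (K + 1) - ?R" by (simp add: Re_h algebra_simps)
        ultimately show ?case using elim by (simp only: diff_divide_distrib add_divide_distrib) simp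
      qed
    qed
  qed
  have u_bdd: "Re (g z) \<le> K + 1" if "1 < Im z" for z
  proof (rule ccontr)
    assume "\<not> ?thesis"
    then have "Re (h (z - \<i>)) < K * Im (z - \<i>)" by (simp add: Re_h)
    then have "Re (h (z - \<i>)) / Im (z - \<i>) < K" using that by (simp add: field_simps)
    then obtain e where e: "Re (h (z - \<i>)) / Im (z - \<i>) < e" "e < K" using dense by blast
    have "\<forall>\<^sub>F t in at_top. Re (h (\<i> * of_real t)) / t < e"
      by (rule harnack_growth_rate[OF h_hol h_pos _ e(1)]) (use that in auto)
    moreover have "\<forall>\<^sub>F t in at_top. e < Re (h (\<i> * of_real t)) / t"
      using h_lim e(2) by (rule order_tendstoD)
    ultimately have "\<forall>\<^sub>F t in (at_top :: real filter). False" by eventually_elim simp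
    then show False by simp
  qed
  have split: "f z = expsum (\<lambda>n. if \<not> w n < m then q n else 0) w z" for z
    using expsum_split[of z "\<lambda>n. w n < m"] low_frequencies_vanish[OF decay] by simp
  let ?U = "\<lambda>n. if \<not> w n < m then q n else 0"
  interpret U: exponential_sum ?U w W by (rule restrict)
  have "((\<lambda>t. \<Sum>n. ?U n * wave (w n - m) (\<i> * of_real t)) \<longlongrightarrow> (\<Sum>n. if w n = m then q n else 0)) (at_top :: real filter)"
  proof (rule suminf_tendsto)
    fix n
    show "((\<lambda>t. ?U n * wave (w n - m) (\<i> * of_real t)) \<longlongrightarrow> (if w n = m then q n else 0)) (at_top :: real filter)"
    proof (cases "w n > m")
      case True
      then have "((\<lambda>t::real. norm (q n) * exp (- (2 * pi * (w n - m) * t))) \<longlongrightarrow> 0) at_top"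
        by real_asymp
      then have "((\<lambda>t. ?U n * wave (w n - m) (\<i> * of_real t)) \<longlongrightarrow> 0) (at_top :: real filter)"
        by (rule Lim_null_comparison[rotated]) (use True in \<open>auto simp: norm_mult norm_wave\<close>)
      then show ?thesis using True by simp
    qed auto
  next
    show "\<forall>\<^sub>F t::real in at_top. \<forall>n. norm (?U n * wave (w n - m) (\<i> * of_real t)) \<le> norm (q n)"
      using eventually_ge_at_top[of 0]
    proof eventually_elim
      case (elim t)
      show ?case
      proof
        fix n
        show "norm (?U n * wave (w n - m) (\<i> * of_real t)) \<le> norm (q n)"
          using elim by (auto simp: norm_mult norm_wave intro!: mult_right_le_one_le)
      qed
    qed
  qed (auto intro: coeffs)
  moreover have "(\<Sum>n. ?U n * wave (w n - m) z) = f z * wave (- m) z" for z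
  proof -
    have "(\<lambda>n. ?U n * wave (w n) z * wave (- m) z) sums (f z * wave (- m) z)"
      unfolding split by (intro sums_mult2 U.expsum_sums)
    then have "(\<lambda>n. ?U n * wave (w n - m) z) sums (f z * wave (- m) z)"
      using wave_add_freq[of "w _" "- m" z] by (simp add: mult.assoc)
    then show ?thesis by (simp add: sums_iff)
  qed
  ultimately have lim: "((\<lambda>t. norm (f (\<i> * of_real t) * wave (- m) (\<i> * of_real t))) \<longlongrightarrow>
      norm (\<Sum>n. if w n = m then q n else 0)) (at_top :: real filter)"
    by (intro tendsto_norm) simp
  have "2 * Q * exp (- (K + 1)) \<le> norm (\<Sum>n. if w n = m then q n else 0)"
  proof (rule tendsto_lowerbound[OF lim])
    show "\<forall>\<^sub>F t::real in at_top. 2 * Q * exp (- (K + 1)) \<le> norm (f (\<i> * of_real t) * wave (- m) (\<i> * of_real t))"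
      using eventually_gt_at_top[of 1]
    proof eventually_elim
      case (elim t)
      have "norm (f (\<i> * of_real t) * wave (- m) (\<i> * of_real t)) = 2 * Q * exp (- Re (g (\<i> * of_real t)))"
        using nf[of "\<i> * of_real t"] elim
        by (simp add: norm_mult norm_wave mult.assoc flip: exp_add)
      then show ?case using u_bdd[of "\<i> * of_real t"] elim Qpos by simp
    qed
  qed simp
  moreover have "0 < 2 * Q * exp (- (K + 1))" using Qpos by simp
  ultimately have "0 < norm (\<Sum>n. if w n = m then q n else 0)" by linarith
  then have "(\<Sum>n. if w n = m then q n else 0) \<noteq> 0" by auto
  with split that show ?thesis by blast
qed

end

section \<open>The algebra of absolutely convergent series of waves\<close>

text \<open>The bound \<open>B\<close> dominates the Wiener norm. Keeping it in the predicate is what makes countable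
  sums, and with them the geometric series, available.\<close>

definition wave_series :: "(real \<Rightarrow> complex) \<Rightarrow> real \<Rightarrow> bool" where
  "wave_series h B \<longleftrightarrow> (\<exists>b l. summable (\<lambda>k::nat. norm (b k)) \<and> (\<Sum>k. norm (b k)) \<le> B \<and>
     (\<forall>x. h x = (\<Sum>k. b k * wave (l k) (of_real x))))"

lemma norm_wave_real [simp]: "norm (wave l (of_real x)) = 1"
  by (simp add: norm_wave)

lemma wave_seriesI:
  assumes "summable (\<lambda>k. norm (b k))" "(\<Sum>k. norm (b k)) \<le> B"
    "\<And>x. h x = (\<Sum>k. b k * wave (l k) (of_real x))"
  shows "wave_series h B"
  unfolding wave_series_def using assms by blast

lemma wave_series_mono: "wave_series h B \<Longrightarrow> B \<le> C \<Longrightarrow> wave_series h C"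
  unfolding wave_series_def by force

lemma wave_series_norm_le:
  assumes "wave_series h B"
  shows "norm (h x) \<le> B"
proof -
  obtain b l where b: "summable (\<lambda>k. norm (b k))" "(\<Sum>k. norm (b k)) \<le> B"
    "\<And>x. h x = (\<Sum>k. b k * wave (l k) (of_real x))"
    using assms unfolding wave_series_def by blast
  have "norm (h x) \<le> (\<Sum>k. norm (b k))"
    unfolding b(3) by (rule norm_suminf_le) (use b(1) in \<open>auto simp: norm_mult\<close>)
  with b(2) show ?thesis by linarith
qed

lemma wave_series_const: "wave_series (\<lambda>x. c) (norm c)"
proof (rule wave_seriesI)
  show "summable (\<lambda>k. norm (if k = (0::nat) then c else 0))"
    by (rule summable_finite[of "{0}"]) auto
  show "(\<Sum>k. norm (if k = (0::nat) then c else 0)) \<le> norm c"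
    by (subst suminf_finite[of "{0}"]) auto
  show "c = (\<Sum>k. (if k = (0::nat) then c else 0) * wave 0 (of_real x))" for x
    by (subst suminf_finite[of "{0}"]) auto
qed

lemma wave_series_shift:
  assumes "wave_series h B"
  shows "wave_series (\<lambda>x. c * wave m (of_real x) * h x) (norm c * B)"
proof -
  obtain b l where b: "summable (\<lambda>k. norm (b k))" "(\<Sum>k. norm (b k)) \<le> B"
    "\<And>x. h x = (\<Sum>k. b k * wave (l k) (of_real x))"
    using assms unfolding wave_series_def by blast
  show ?thesis
  proof (rule wave_seriesI)
    show "summable (\<lambda>k. norm (c * b k))" using b(1) by (simp add: norm_mult summable_mult)
    show "(\<Sum>k. norm (c * b k)) \<le> norm c * B"
      using b(1,2) by (simp add: norm_mult suminf_mult mult_left_mono)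
    fix x :: real
    have "summable (\<lambda>k. b k * wave (l k) (of_real x))"
      by (rule summable_norm_cancel) (simp add: norm_mult b(1))
    then have "c * wave m (of_real x) * h x = (\<Sum>k. c * wave m (of_real x) * (b k * wave (l k) (of_real x)))"
      unfolding b(3) by (simp add: suminf_mult)
    then show "c * wave m (of_real x) * h x = (\<Sum>k. c * b k * wave (m + l k) (of_real x))"
      by (simp add: wave_add_freq mult_ac)
  qed
qed

text \<open>The double series is enumerated by \<open>prod_decode\<close>, so that all representations keep the natural
  numbers as index set.\<close>

lemma double_series:
  fixes a :: "nat \<Rightarrow> nat \<Rightarrow> 'a :: banach"
  assumes inner: "\<And>j. summable (\<lambda>k. norm (a j k))" "\<And>j. (\<Sum>k. norm (a j k)) \<le> B j" and "summable B"
  shows "summable (\<lambda>i. norm (case_prod a (prod_decode i)))"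
    "(\<Sum>i. case_prod a (prod_decode i)) = (\<Sum>j. \<Sum>k. a j k)"
proof -
  have in_sum: "((\<lambda>k. norm (a j k)) has_sum (\<Sum>k. norm (a j k))) UNIV" for j
    by (intro norm_summable_imp_has_sum summable_sums) (use inner(1) in auto)
  have B0: "0 \<le> B j" for j using inner[of j] suminf_nonneg[OF inner(1)[of j]] by force
  have nn: "0 \<le> (\<Sum>k. norm (a j k))" for j by (intro suminf_nonneg inner(1)) auto
  have "summable (\<lambda>j. norm (\<Sum>k. norm (a j k)))"
    by (rule summable_comparison_test'[OF \<open>summable B\<close>]) (use inner(2) nn in auto)
  then have "(\<lambda>j. \<Sum>k. norm (a j k)) summable_on UNIV"
    by (rule norm_summable_imp_summable_on)
  then have "(\<lambda>x. norm (case_prod a x)) summable_on (SIGMA j:UNIV. UNIV)"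
    by (intro summable_on_SigmaI[where g = "\<lambda>j. \<Sum>k. norm (a j k)"]) (use in_sum in auto)
  then have abs: "(\<lambda>x. norm (case_prod a x)) summable_on UNIV" by simp
  have bij: "bij_betw prod_decode UNIV UNIV" by (rule bij_prod_decode)
  have "(\<lambda>i. norm (case_prod a (prod_decode i))) summable_on UNIV"
    using summable_on_reindex_bij_betw[OF bij, of "\<lambda>x. norm (case_prod a x)"] abs by simp
  then show sn: "summable (\<lambda>i. norm (case_prod a (prod_decode i)))"
    by (rule summable_on_imp_summable)
  have a_has: "((\<lambda>k. a j k) has_sum (\<Sum>k. a j k)) UNIV" for j
    by (rule norm_summable_imp_has_sum[OF inner(1) summable_sums[OF summable_norm_cancel[OF inner(1)]]])
  have "(\<Sum>i. case_prod a (prod_decode i)) = infsum (\<lambda>i. case_prod a (prod_decode i)) UNIV"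
    by (rule infsumI[symmetric], rule norm_summable_imp_has_sum[OF sn], rule summable_sums, rule summable_norm_cancel[OF sn])
  also have "\<dots> = infsum (case_prod a) UNIV"
    by (rule infsum_reindex_bij_betw[OF bij])
  also have "\<dots> = infsum (\<lambda>j. infsum (\<lambda>k. a j k) UNIV) UNIV"
    using infsum_Sigma'_banach[of a UNIV "\<lambda>_. UNIV"] abs_summable_summable[OF abs] by simp
  also have "\<dots> = infsum (\<lambda>j. \<Sum>k. a j k) UNIV"
    by (simp add: infsumI[OF a_has])
  also have "\<dots> = (\<Sum>j. \<Sum>k. a j k)"
  proof -
    have ns: "summable (\<lambda>j. norm (\<Sum>k. a j k))"
      by (rule summable_comparison_test'[OF \<open>summable B\<close>])
        (use inner(2) summable_norm[OF inner(1)] in \<open>auto intro: order_trans\<close>)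
    show ?thesis
      by (rule infsumI, rule norm_summable_imp_has_sum[OF ns], rule summable_sums, rule summable_norm_cancel[OF ns])
  qed
  finally show "(\<Sum>i. case_prod a (prod_decode i)) = (\<Sum>j. \<Sum>k. a j k)" .
qed

lemma wave_series_suminf:
  assumes "\<And>j. wave_series (h j) (B j)" "summable B"
  shows "wave_series (\<lambda>x. \<Sum>j. h j x) (suminf B)"
proof -
  have "\<forall>j. \<exists>c. summable (\<lambda>k. norm (fst c k)) \<and> (\<Sum>k. norm (fst c k)) \<le> B j \<and>
      (\<forall>x. h j x = (\<Sum>k. fst c k * wave (snd c k) (of_real x)))"
    using assms(1) by (simp add: wave_series_def)
  from choice[OF this] obtain c where c: "\<forall>j. summable (\<lambda>k. norm (fst (c j) k)) \<and> (\<Sum>k. norm (fst (c j) k)) \<le> B j \<and>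
      (\<forall>x. h j x = (\<Sum>k. fst (c j) k * wave (snd (c j) k) (of_real x)))" ..
  define b l where "b j = fst (c j)" and "l j = snd (c j)" for j
  have b: "summable (\<lambda>k. norm (b j k))" "(\<Sum>k. norm (b j k)) \<le> B j"
    "h j x = (\<Sum>k. b j k * wave (l j k) (of_real x))" for j x
    using c by (simp_all add: b_def l_def)
  show ?thesis
  proof (rule wave_seriesI)
    show "summable (\<lambda>i. norm (case_prod b (prod_decode i)))"
      by (rule double_series(1)[OF b(1,2) assms(2)])
    have "(\<Sum>i. case_prod (\<lambda>j k. norm (b j k)) (prod_decode i)) = (\<Sum>j. \<Sum>k. norm (b j k))"
      by (rule double_series(2)[OF _ _ assms(2)]) (use b in auto)
    also have "\<dots> \<le> suminf B"
    proof (rule suminf_le[OF b(2) _ assms(2)])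
      show "summable (\<lambda>j. \<Sum>k. norm (b j k))"
        by (rule summable_comparison_test'[OF assms(2)])
          (use b(2) suminf_nonneg[OF b(1)] in auto)
    qed
    finally show "(\<Sum>i. norm (case_prod b (prod_decode i))) \<le> suminf B"
      by (simp add: case_prod_unfold)
    fix x :: real
    have "(\<Sum>i. case_prod (\<lambda>j k. b j k * wave (l j k) (of_real x)) (prod_decode i)) = (\<Sum>j. h j x)"
      unfolding b(3) by (rule double_series(2)[OF _ _ assms(2)]) (use b in \<open>auto simp: norm_mult\<close>)
    then show "(\<Sum>j. h j x) = (\<Sum>i. case_prod b (prod_decode i) * wave (case_prod l (prod_decode i)) (of_real x))"
      by (simp add: case_prod_unfold)
  qed
qed

lemma wave_series_mult:
  assumes "wave_series h B" "wave_series g C"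
  shows "wave_series (\<lambda>x. h x * g x) (B * C)"
proof -
  obtain b l where b: "summable (\<lambda>k. norm (b k))" "(\<Sum>k. norm (b k)) \<le> B"
    "\<And>x. h x = (\<Sum>k. b k * wave (l k) (of_real x))"
    using assms(1) unfolding wave_series_def by blast
  have "0 \<le> C" using wave_series_norm_le[OF assms(2), of 0] norm_ge_zero order_trans by blast
  have "wave_series (\<lambda>x. \<Sum>j. b j * wave (l j) (of_real x) * g x) (\<Sum>j. norm (b j) * C)"
    by (intro wave_series_suminf wave_series_shift assms summable_mult2 b)
  moreover have "(\<Sum>j. norm (b j) * C) \<le> B * C"
    using suminf_mult2[OF b(1), of C] mult_right_mono[OF b(2) \<open>0 \<le> C\<close>] by simp
  moreover have "(\<Sum>j. b j * wave (l j) (of_real x) * g x) = h x * g x" for x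
    unfolding b(3)
    by (rule suminf_mult2[symmetric, OF summable_norm_cancel]) (simp add: norm_mult b(1))
  ultimately show ?thesis using wave_series_mono by simp
qed

lemma wave_series_power: "wave_series h B \<Longrightarrow> wave_series (\<lambda>x. h x ^ k) (B ^ k)"
proof (induction k)
  case 0
  then show ?case using wave_series_const[of 1] by simp
next
  case (Suc k)
  then show ?case using wave_series_mult by simp
qed

text \<open>Inversion needs no more than the geometric series here, since the
  perturbation \<open>r\<close> is small in the Wiener norm and not only in the supremum norm.\<close>

lemma wave_series_inverse:
  assumes "wave_series r R" "R < 1"
  shows "wave_series (\<lambda>x. 1 / (1 + r x)) (1 / (1 - R))"
proof -
  have "0 \<le> R" using wave_series_norm_le[OF assms(1), of 0] norm_ge_zero order_trans by blast
  have m: "wave_series (\<lambda>x. - r x) R"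
    using wave_series_shift[OF assms(1), of "-1" 0] by simp
  have "wave_series (\<lambda>x. \<Sum>k. (- r x) ^ k) (\<Sum>k. R ^ k)"
    by (intro wave_series_suminf wave_series_power m summable_geometric) (use assms \<open>0 \<le> R\<close> in auto)
  moreover have "(\<Sum>k. R ^ k) = 1 / (1 - R)" using assms \<open>0 \<le> R\<close> by (intro suminf_geometric) auto
  moreover have "(\<Sum>k. (- r x) ^ k) = 1 / (1 + r x)" for x
    using suminf_geometric[of "- r x"] wave_series_norm_le[OF m, of x] assms(2) by simp
  ultimately show ?thesis by simp
qed

context exponential_sum
begin

lemma wave_series_on_line:
  "wave_series (\<lambda>x. f (Complex x s)) (\<Sum>n. norm (q n * wave (w n) (\<i> * of_real s)))"
proof (rule wave_seriesI[where b = "\<lambda>n. q n * wave (w n) (\<i> * of_real s)" and l = w])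
  show "f (Complex x s) = (\<Sum>n. q n * wave (w n) (\<i> * of_real s) * wave (w n) (of_real x))" for x
  proof -
    have "Complex x s = \<i> * of_real s + of_real x" by (simp add: complex_eq_iff)
    then show ?thesis by (simp add: expsum_def wave_add mult_ac)
  qed
qed (use summable_norm_terms in auto)

text \<open>Factoring out the lowest wave leaves \<open>q0 + U\<close> with \<open>q0 \<noteq> 0\<close> and only positive frequencies in \<open>U\<close>;
  on \<open>Im z = s\<close> these are damped by \<open>exp (- 2 * pi * s * (w n - m))\<close>, so the geometric series
  applies for large \<open>s\<close>.\<close>

lemma log_deriv_wave_series:
  assumes nz: "\<And>z. 0 < Im z \<Longrightarrow> f z \<noteq> 0"
  shows "\<forall>\<^sub>F s in at_top. \<exists>B. wave_series (\<lambda>x. deriv f (Complex x s) / f (Complex x s)) B"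
proof -
  obtain m where m: "\<And>z. f z = expsum (\<lambda>n. if \<not> w n < m then q n else 0) w z"
    "(\<Sum>n. if w n = m then q n else 0) \<noteq> 0"
    using lowest_frequency_attained[OF nz] by blast
  define q0 where "q0 = (\<Sum>n. if w n = m then q n else 0)"
  let ?U = "\<lambda>n. if m < w n then q n else 0"
  interpret U: exponential_sum ?U "\<lambda>n. w n - m" "W + \<bar>m\<bar>"
  proof
    show "summable (\<lambda>n. norm (?U n))" by (rule exponential_sum.coeffs[OF restrict])
    show "\<bar>w n - m\<bar> \<le> W + \<bar>m\<bar>" for n using freqs[of n] by linarith
  qed
  interpret L: exponential_sum "\<lambda>n. if \<not> w n < m then q n else 0" w W by (rule restrict)
  interpret D: exponential_sum "\<lambda>n. 2 * of_real pi * \<i> * of_real (w n) * q n" w W by (rule derivative_series)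
  have factor: "f z = wave m z * (q0 + U.f z)" for z
  proof -
    have "summable (\<lambda>n. if w n = m then q n else 0)"
      by (rule summable_norm_cancel, rule exponential_sum.coeffs[OF restrict])
    then have "(\<lambda>n. if w n = m then q n else 0) sums q0" unfolding q0_def by (rule summable_sums)
    from sums_mult[OF sums_add[OF this U.expsum_sums[of z]], of "wave m z"]
    have "(\<lambda>n. wave m z * ((if w n = m then q n else 0) + ?U n * wave (w n - m) z)) sums (wave m z * (q0 + U.f z))" .
    moreover have "wave m z * ((if w n = m then q n else 0) + ?U n * wave (w n - m) z)
        = (if \<not> w n < m then q n else 0) * wave (w n) z" for n
      using wave_add_freq[of m "w n - m" z] by auto
    ultimately have "(\<lambda>n. (if \<not> w n < m then q n else 0) * wave (w n) z) sums (wave m z * (q0 + U.f z))"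
      by simp
    with L.expsum_sums[of z] show ?thesis unfolding m(1)[of z] using sums_unique2 by blast
  qed
  let ?R = "\<lambda>s. \<Sum>n. norm (?U n * wave (w n - m) (\<i> * of_real s))"
  have "(?R \<longlongrightarrow> (\<Sum>n. 0)) at_top"
  proof (rule suminf_tendsto)
    fix n
    show "((\<lambda>s. norm (?U n * wave (w n - m) (\<i> * of_real s))) \<longlongrightarrow> 0) at_top"
    proof (cases "m < w n")
      case True
      then have "((\<lambda>t::real. norm (q n) * exp (- (2 * pi * (w n - m) * t))) \<longlongrightarrow> 0) at_top"
        by real_asymp
      then show ?thesis using True by (simp add: norm_mult norm_wave)
    qed simp
  next
    show "\<forall>\<^sub>F s in at_top. \<forall>n. norm (norm (?U n * wave (w n - m) (\<i> * of_real s))) \<le> norm (q n)"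
      using eventually_ge_at_top[of 0]
    proof eventually_elim
      case (elim t)
      show ?case
      proof
        fix n
        show "norm (norm (?U n * wave (w n - m) (\<i> * of_real t))) \<le> norm (q n)"
          using elim by (auto simp: norm_mult norm_wave intro!: mult_right_le_one_le)
      qed
    qed
  qed (auto intro: coeffs)
  then have "\<forall>\<^sub>F s in at_top. ?R s < norm q0"
    using m(2) by (intro order_tendstoD(2)) (auto simp: q0_def)
  then show ?thesis
  proof eventually_elim
    case (elim s)
    have "wave_series (\<lambda>x. 1 / q0 * wave 0 (of_real x) * U.f (Complex x s)) (norm (1 / q0) * ?R s)"
      by (intro wave_series_shift U.wave_series_on_line)
    then have "wave_series (\<lambda>x. 1 / (1 + 1 / q0 * wave 0 (of_real x) * U.f (Complex x s))) (1 / (1 - norm (1 / q0) * ?R s))"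
      using elim m(2) by (intro wave_series_inverse) (auto simp: q0_def[symmetric] norm_divide divide_less_eq_1)
    from wave_series_mult[OF this wave_series_shift[OF D.wave_series_on_line[of s], of "wave (- m) (\<i> * of_real s) / q0" "- m"]]
    obtain B where "wave_series (\<lambda>x. 1 / (1 + 1 / q0 * wave 0 (of_real x) * U.f (Complex x s)) *
       (wave (- m) (\<i> * of_real s) / q0 * wave (- m) (of_real x) * D.f (Complex x s))) B" by blast
    moreover have "1 / (1 + 1 / q0 * wave 0 (of_real x) * U.f (Complex x s)) *
       (wave (- m) (\<i> * of_real s) / q0 * wave (- m) (of_real x) * D.f (Complex x s))
       = deriv f (Complex x s) / f (Complex x s)" for x
    proof -
      have "q0 \<noteq> 0" using m(2) by (simp add: q0_def)
      have "Complex x s = \<i> * of_real s + of_real x" by (simp add: complex_eq_iff)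
      then have "wave (- m) (\<i> * of_real s) * wave (- m) (of_real x) = 1 / wave m (Complex x s)"
        using wave_add_freq[of m "- m" "Complex x s"] by (simp add: wave_add field_simps)
      then have "1 / (1 + 1 / q0 * wave 0 (of_real x) * U.f (Complex x s)) *
       (wave (- m) (\<i> * of_real s) / q0 * wave (- m) (of_real x) * D.f (Complex x s))
        = 1 / (1 + U.f (Complex x s) / q0) * (1 / wave m (Complex x s) / q0 * D.f (Complex x s))"
        by simp
      also have "\<dots> = D.f (Complex x s) / (wave m (Complex x s) * (q0 * (1 + U.f (Complex x s) / q0)))"
        by simp
      also have "q0 * (1 + U.f (Complex x s) / q0) = q0 + U.f (Complex x s)"
        using \<open>q0 \<noteq> 0\<close> by (simp add: algebra_simps)
      finally show ?thesis by (simp only: deriv_expsum factor)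
    qed
    ultimately show ?case by auto
  qed
qed

end

section \<open>Fourier inversion for functions with compact support\<close>

lemma wave_of_real: "wave u (of_real x) = iexp (2 * pi * u * x)"
  by (simp add: wave_def mult_ac)

lemma integrable_inverse_square: "integrable lborel (\<lambda>x::real. C / (1 + x\<^sup>2))"
proof -
  have "integrable lborel (\<lambda>x::real. inverse (1 + x\<^sup>2))"
    using integrable_inverse_1_plus_square by (simp add: set_integrable_def einterval_def)
  from integrable_mult_right[OF this, of C] show ?thesis by (simp add: divide_inverse)
qed

lemma compact_support_integrable:
  fixes \<phi> :: "real \<Rightarrow> complex"
  assumes cont: "continuous_on UNIV \<phi>" and supp: "\<And>t. L < \<bar>t\<bar> \<Longrightarrow> \<phi> t = 0"
  shows "integrable lborel \<phi>" "integral\<^sup>L lborel \<phi> = integral {-L..L} \<phi>"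
proof -
  have si: "set_integrable lborel {-L..L} \<phi>"
    by (intro borel_integrable_atLeastAtMost' continuous_on_subset[OF cont]) auto
  have eq: "(\<lambda>t. indicator {-L..L} t *\<^sub>R \<phi> t) = \<phi>"
  proof
    fix t show "indicator {-L..L} t *\<^sub>R \<phi> t = \<phi> t" using supp[of t] by (cases "\<bar>t\<bar> \<le> L") (auto simp: indicator_def abs_le_iff)
  qed
  show "integrable lborel \<phi>" using si unfolding set_integrable_def eq .
  show "integral\<^sup>L lborel \<phi> = integral {-L..L} \<phi>"
    using set_borel_integral_eq_integral(2)[OF si] unfolding set_lebesgue_integral_def eq .
qed

lemma integrable_gaussian:
  assumes "0 < \<sigma>" shows "integrable lborel (\<lambda>x::real. exp (- (\<sigma> * x)\<^sup>2 / 2))"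
proof -
  have "integrable lborel (\<lambda>x. sqrt (2 * pi * (1/\<sigma>)\<^sup>2) * normal_density 0 (1/\<sigma>) x)"
    using assms by (intro integrable_mult_right integrable_normal_density) auto
  moreover have "sqrt (2 * pi * (1/\<sigma>)\<^sup>2) * normal_density 0 (1/\<sigma>) x = exp (- (\<sigma> * x)\<^sup>2 / 2)" for x
    using assms by (simp add: normal_density_def power_divide power_mult_distrib real_sqrt_divide)
  ultimately show ?thesis by simp
qed

text \<open>The characteristic function of the standard normal distribution, rescaled.\<close>

lemma gaussian_wave_integral:
  assumes "0 < \<sigma>"
  shows "(LINT x|lborel. wave u (of_real x) * of_real (exp (- (\<sigma> * x)\<^sup>2 / 2)))
    = of_real (sqrt (2 * pi) / \<sigma> * exp (- (2 * pi * u / \<sigma>)\<^sup>2 / 2))"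
proof -
  have char: "(LINT y|lborel. std_normal_density y *\<^sub>R iexp (t * y)) = of_real (exp (- t\<^sup>2 / 2))" for t
    using fun_cong[OF char_std_normal_distribution, of t] unfolding char_def
    by (subst (asm) integral_density) auto
  have "(LINT x|lborel. wave u (of_real x) * of_real (exp (- (\<sigma> * x)\<^sup>2 / 2)))
     = \<bar>1/\<sigma>\<bar> *\<^sub>R (LINT y|lborel. wave u (of_real (0 + 1/\<sigma> * y)) * of_real (exp (- (\<sigma> * (0 + 1/\<sigma> * y))\<^sup>2 / 2)))"
    using assms by (intro lborel_integral_real_affine) auto
  also have "(\<lambda>y. wave u (of_real (0 + 1/\<sigma> * y)) * of_real (exp (- (\<sigma> * (0 + 1/\<sigma> * y))\<^sup>2 / 2)))
     = (\<lambda>y. sqrt (2 * pi) *\<^sub>R (std_normal_density y *\<^sub>R iexp (2 * pi * u / \<sigma> * y)))"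
    using assms unfolding wave_of_real by (auto simp: fun_eq_iff std_normal_density_def scaleR_conv_of_real)
  also have "(LINT y|lborel. sqrt (2 * pi) *\<^sub>R (std_normal_density y *\<^sub>R iexp (2 * pi * u / \<sigma> * y)))
      = sqrt (2 * pi) *\<^sub>R of_real (exp (- (2 * pi * u / \<sigma>)\<^sup>2 / 2))"
    unfolding integral_scaleR_right char ..
  finally show ?thesis using assms by (simp add: scaleR_conv_of_real)
qed

lemma borel_measurable_wave [measurable]: "(\<lambda>x. wave u (of_real x)) \<in> borel_measurable borel"
  by (intro borel_measurable_continuous_onI continuous_intros)

lemma wave_of_real_swap: "wave u (of_real v) = wave v (of_real u)"
  by (simp add: wave_def mult_ac)

text \<open>The Gaussian factor makes Fubini applicable; the inner integral is again a Gaussian,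
  which concentrates at \<open>l\<close> as \<open>\<sigma>\<close> tends to \<open>0\<close>.\<close>

lemma gaussian_regularised_inversion:
  fixes \<phi> :: "real \<Rightarrow> complex"
  assumes cont: "continuous_on UNIV \<phi>" and supp: "\<And>t. L < \<bar>t\<bar> \<Longrightarrow> \<phi> t = 0" and "0 < \<sigma>"
  shows "(LINT x|lborel. (LINT t|lborel. \<phi> t * wave (- t) (of_real x)) * wave l (of_real x) * of_real (exp (- (\<sigma> * x)\<^sup>2 / 2)))
    = (LINT v|lborel. std_normal_density v *\<^sub>R \<phi> (l + \<sigma> / (2 * pi) * v))"
proof -
  let ?E = "\<lambda>x. exp (- (\<sigma> * x)\<^sup>2 / 2)"
  define h where "h x t = \<phi> t * wave (l - t) (of_real x) * of_real (?E x)" for x t :: real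
  have \<phi>m [measurable]: "\<phi> \<in> borel_measurable borel" by (rule borel_measurable_continuous_onI[OF cont])
  have \<phi>i: "integrable lborel \<phi>" by (rule compact_support_integrable[OF cont supp])
  have nh: "norm (h x t) = norm (\<phi> t) * ?E x" for x t by (simp add: h_def norm_mult)
  have "continuous_on UNIV (\<lambda>p. wave (l - snd p) (of_real (fst p)) * of_real (?E (fst p)) :: complex)"
    unfolding wave_def by (intro continuous_intros) auto
  then have m1: "(\<lambda>p. wave (l - snd p) (of_real (fst p)) * of_real (?E (fst p)) :: complex) \<in> borel_measurable (lborel \<Otimes>\<^sub>M lborel)"
    by (simp add: lborel_prod borel_measurable_continuous_onI)
  have hm: "case_prod h \<in> borel_measurable (lborel \<Otimes>\<^sub>M lborel)"
    unfolding h_def case_prod_unfold mult.assoc using m1 by measurable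
  have "integrable (lborel \<Otimes>\<^sub>M lborel) (case_prod h)"
  proof (rule lborel_pair.Fubini_integrable[OF hm])
    show "integrable lborel (\<lambda>x. LINT y|lborel. norm (case_prod h (x, y)))"
      using integrable_gaussian[OF \<open>0 < \<sigma>\<close>] by (simp add: nh)
    have "integrable lborel (h x)" for x
    proof (rule Bochner_Integration.integrable_bound)
      show "integrable lborel (\<lambda>t. ?E x *\<^sub>R \<phi> t)" using \<phi>i by simp
      show "h x \<in> borel_measurable lborel"
        unfolding h_def wave_of_real_swap[of _ x] by measurable
      show "AE t in lborel. norm (h x t) \<le> norm (?E x *\<^sub>R \<phi> t)" by (simp add: nh)
    qed
    then show "AE x in lborel. integrable lborel (\<lambda>y. case_prod h (x, y))" by simp
  qed
  from lborel_pair.Fubini_integral[OF this]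
  have swap: "(LINT x|lborel. LINT t|lborel. h x t) = (LINT t|lborel. LINT x|lborel. h x t)" by simp
  have "(LINT t|lborel. \<phi> t * wave (- t) (of_real x)) * wave l (of_real x) * of_real (?E x) = (LINT t|lborel. h x t)" for x
  proof -
    have "(LINT t|lborel. \<phi> t * wave (- t) (of_real x)) * (wave l (of_real x) * of_real (?E x))
        = (LINT t|lborel. \<phi> t * wave (- t) (of_real x) * (wave l (of_real x) * of_real (?E x)))"
      by (rule integral_mult_left_zero[symmetric])
    also have "(\<lambda>t. \<phi> t * wave (- t) (of_real x) * (wave l (of_real x) * of_real (?E x))) = h x"
      using wave_add_freq[of l "- _" "of_real x"] by (simp add: fun_eq_iff h_def)
    finally show ?thesis by (simp add: mult.assoc)
  qed
  then have "(LINT x|lborel. (LINT t|lborel. \<phi> t * wave (- t) (of_real x)) * wave l (of_real x) * of_real (?E x))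
      = (LINT t|lborel. LINT x|lborel. h x t)"
    by (simp add: swap)
  also have "(\<lambda>t. LINT x|lborel. h x t) = (\<lambda>t. \<phi> t * of_real (sqrt (2 * pi) / \<sigma> * exp (- (2 * pi * (l - t) / \<sigma>)\<^sup>2 / 2)))"
    unfolding h_def mult.assoc integral_mult_right_zero gaussian_wave_integral[OF \<open>0 < \<sigma>\<close>] ..
  also have "(LINT t|lborel. \<phi> t * of_real (sqrt (2 * pi) / \<sigma> * exp (- (2 * pi * (l - t) / \<sigma>)\<^sup>2 / 2)))
     = \<bar>\<sigma> / (2 * pi)\<bar> *\<^sub>R (LINT v|lborel. \<phi> (l + \<sigma> / (2 * pi) * v) *
          of_real (sqrt (2 * pi) / \<sigma> * exp (- (2 * pi * (l - (l + \<sigma> / (2 * pi) * v)) / \<sigma>)\<^sup>2 / 2)))"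
    using \<open>0 < \<sigma>\<close> by (intro lborel_integral_real_affine) auto
  also have "\<dots> = (LINT v|lborel. (\<sigma> / (2 * pi)) *\<^sub>R (\<phi> (l + \<sigma> / (2 * pi) * v) *
          of_real (sqrt (2 * pi) / \<sigma> * exp (- (2 * pi * (l - (l + \<sigma> / (2 * pi) * v)) / \<sigma>)\<^sup>2 / 2))))"
    using \<open>0 < \<sigma>\<close> by simp
  also have "(\<lambda>v. (\<sigma> / (2 * pi)) *\<^sub>R (\<phi> (l + \<sigma> / (2 * pi) * v) *
          of_real (sqrt (2 * pi) / \<sigma> * exp (- (2 * pi * (l - (l + \<sigma> / (2 * pi) * v)) / \<sigma>)\<^sup>2 / 2))))
     = (\<lambda>v. std_normal_density v *\<^sub>R \<phi> (l + \<sigma> / (2 * pi) * v))"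
  proof
    fix v
    have "2 * pi * (l - (l + \<sigma> / (2 * pi) * v)) / \<sigma> = - v" using \<open>0 < \<sigma>\<close> by simp
    moreover have "\<sigma> / (2 * pi) * (sqrt (2 * pi) / \<sigma>) = 1 / sqrt (2 * pi)"
      using \<open>0 < \<sigma>\<close> real_sqrt_mult_self[of "2 * pi"] by (simp add: field_simps del: real_sqrt_mult_self)
    ultimately have "\<sigma> / (2 * pi) * (sqrt (2 * pi) / \<sigma> * exp (- (2 * pi * (l - (l + \<sigma> / (2 * pi) * v)) / \<sigma>)\<^sup>2 / 2))
        = std_normal_density v"
      unfolding std_normal_density_def mult.assoc[symmetric] by simp
    moreover have "a *\<^sub>R (P * of_real b) = (a * b) *\<^sub>R P" for a b :: real and P :: complex
      by (simp add: scaleR_conv_of_real)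
    ultimately show "(\<sigma> / (2 * pi)) *\<^sub>R (\<phi> (l + \<sigma> / (2 * pi) * v) *
          of_real (sqrt (2 * pi) / \<sigma> * exp (- (2 * pi * (l - (l + \<sigma> / (2 * pi) * v)) / \<sigma>)\<^sup>2 / 2)))
     = std_normal_density v *\<^sub>R \<phi> (l + \<sigma> / (2 * pi) * v)"
      by (simp only:)
  qed
  finally show ?thesis .
qed

text \<open>Letting \<open>\<sigma>\<close> tend to \<open>0\<close>, both sides of the regularised identity converge by
  dominated convergence.\<close>

lemma fourier_inversion_compact_support:
  fixes \<phi> :: "real \<Rightarrow> complex"
  assumes cont: "continuous_on UNIV \<phi>" and supp: "\<And>t. L < \<bar>t\<bar> \<Longrightarrow> \<phi> t = 0"
    and int: "integrable lborel (\<lambda>x. LINT t|lborel. \<phi> t * wave (- t) (of_real x))"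
  shows "(LINT x|lborel. (LINT t|lborel. \<phi> t * wave (- t) (of_real x)) * wave l (of_real x)) = \<phi> l"
proof -
  let ?G = "\<lambda>x. LINT t|lborel. \<phi> t * wave (- t) (of_real x)"
  let ?\<sigma> = "\<lambda>n. inverse (real (Suc n))"
  have \<sigma>0: "?\<sigma> \<longlonglongrightarrow> 0" by (rule LIMSEQ_inverse_real_of_nat)
  have Gm: "?G \<in> borel_measurable lborel" using int by (rule borel_measurable_integrable)
  have \<phi>m [measurable]: "\<phi> \<in> borel_measurable borel" by (rule borel_measurable_continuous_onI[OF cont])
  have "(\<lambda>n. LINT x|lborel. ?G x * wave l (of_real x) * of_real (exp (- (?\<sigma> n * x)\<^sup>2 / 2)))
      \<longlonglongrightarrow> (LINT x|lborel. ?G x * wave l (of_real x))"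
  proof (rule integral_dominated_convergence[where w = "\<lambda>x. norm (?G x)"])
    show "integrable lborel (\<lambda>x. norm (?G x))" using int by (rule integrable_norm)
    show "(\<lambda>x. ?G x * wave l (of_real x)) \<in> borel_measurable lborel"
      using Gm by measurable
    show "(\<lambda>x. ?G x * wave l (of_real x) * of_real (exp (- (?\<sigma> n * x)\<^sup>2 / 2))) \<in> borel_measurable lborel" for n
      using Gm by measurable
    have "(\<lambda>n. ?G x * wave l (of_real x) * of_real (exp (- (?\<sigma> n * x)\<^sup>2 / 2))) \<longlonglongrightarrow>
        ?G x * wave l (of_real x) * of_real (exp (- (0 * x)\<^sup>2 / 2))" for x
      by (intro tendsto_intros \<sigma>0) auto
    then show "AE x in lborel. (\<lambda>n. ?G x * wave l (of_real x) * of_real (exp (- (?\<sigma> n * x)\<^sup>2 / 2))) \<longlonglongrightarrow> ?G x * wave l (of_real x)"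
      by simp
    show "AE x in lborel. norm (?G x * wave l (of_real x) * of_real (exp (- (?\<sigma> n * x)\<^sup>2 / 2))) \<le> norm (?G x)" for n
      by (intro AE_I2) (simp add: norm_mult mult_left_le)
  qed
  then have lim: "(\<lambda>n. LINT v|lborel. std_normal_density v *\<^sub>R \<phi> (l + ?\<sigma> n / (2 * pi) * v))
      \<longlonglongrightarrow> (LINT x|lborel. ?G x * wave l (of_real x))"
    by (subst (asm) gaussian_regularised_inversion[OF cont supp]) auto
  obtain B where B: "\<And>t. norm (\<phi> t) \<le> B"
  proof -
    have "bounded (\<phi> ` {-L..L})"
      by (intro compact_imp_bounded compact_continuous_image continuous_on_subset[OF cont]) auto
    then obtain B where B: "\<And>t. t \<in> {-L..L} \<Longrightarrow> norm (\<phi> t) \<le> B" unfolding bounded_iff by blast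
    have "norm (\<phi> t) \<le> max B 0" for t
      using B[of t] supp[of t] by (cases "\<bar>t\<bar> \<le> L") (auto simp: abs_le_iff)
    with that show ?thesis by blast
  qed
  have "(\<lambda>n. LINT v|lborel. std_normal_density v *\<^sub>R \<phi> (l + ?\<sigma> n / (2 * pi) * v))
      \<longlonglongrightarrow> (LINT v|lborel. std_normal_density v *\<^sub>R \<phi> l)"
  proof (rule integral_dominated_convergence[where w = "\<lambda>v. std_normal_density v * B"])
    show "integrable lborel (\<lambda>v. std_normal_density v * B)"
      by (intro integrable_mult_left integrable_normal_density) auto
    have "isCont \<phi> l" using cont by (simp add: continuous_on_eq_continuous_at)
    then have "(\<lambda>n. std_normal_density v *\<^sub>R \<phi> (l + ?\<sigma> n / (2 * pi) * v)) \<longlonglongrightarrow> std_normal_density v *\<^sub>R \<phi> l" for v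
    proof (intro tendsto_intros isCont_tendsto_compose[of l \<phi>])
      have "(\<lambda>n. l + ?\<sigma> n / (2 * pi) * v) \<longlonglongrightarrow> l + 0 / (2 * pi) * v" by (intro tendsto_intros \<sigma>0) auto
      then show "(\<lambda>n. l + ?\<sigma> n / (2 * pi) * v) \<longlonglongrightarrow> l" by simp
    qed
    then show "AE v in lborel. (\<lambda>n. std_normal_density v *\<^sub>R \<phi> (l + ?\<sigma> n / (2 * pi) * v)) \<longlonglongrightarrow> std_normal_density v *\<^sub>R \<phi> l"
      by simp
    show "AE v in lborel. norm (std_normal_density v *\<^sub>R \<phi> (l + ?\<sigma> n / (2 * pi) * v)) \<le> std_normal_density v * B" for n
      by (intro AE_I2) (simp add: B mult_left_mono)
  qed auto
  moreover have "(LINT v|lborel. std_normal_density v *\<^sub>R \<phi> l) = \<phi> l"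
    using integral_scaleR_left[of "\<phi> l" lborel std_normal_density] integral_normal_density[of 1 0]
    by (simp add: integrable_normal_density)
  ultimately show ?thesis using LIMSEQ_unique[OF lim] by simp
qed


text \<open>The Fourier-Laplace transform. Its restriction to the real axis is the Fourier transform.\<close>

definition fourier_ext :: "(real \<Rightarrow> complex) \<Rightarrow> complex \<Rightarrow> complex" where
  "fourier_ext \<phi> z = (LINT t|lborel. \<phi> t * wave (- t) z)"

lemma fourier_eq_fourier_ext: "fourier \<phi> x = fourier_ext \<phi> (of_real x)"
  unfolding fourier_def fourier_ext_def wave_def by (simp add: mult_ac)

locale compactly_supported =
  fixes \<phi> :: "real \<Rightarrow> complex" and L :: real
  assumes cont: "continuous_on UNIV \<phi>" and supp: "\<And>t. L \<le> \<bar>t\<bar> \<Longrightarrow> \<phi> t = 0" and L0: "0 \<le> L"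
begin

lemma cont_integrand: "continuous_on UNIV (\<lambda>t. \<phi> t * wave (- t) z)"
  unfolding wave_def by (intro continuous_intros cont)

lemma fourier_ext_eq: "fourier_ext \<phi> z = integral {-L..L} (\<lambda>t. \<phi> t * wave (- t) z)"
  unfolding fourier_ext_def by (rule compact_support_integrable(2)[OF cont_integrand, of L]) (auto intro: supp)

lemma fourier_ext_holomorphic: "fourier_ext \<phi> holomorphic_on UNIV"
proof -
  have "(\<lambda>z. integral (cbox (-L) L) (\<lambda>t. \<phi> t * wave (- t) z)) holomorphic_on UNIV"
  proof (rule leibniz_rule_holomorphic[where fx = "\<lambda>z t. \<phi> t * (2 * of_real pi * \<i> * of_real (- t) * wave (- t) z)"])
    show "((\<lambda>z. \<phi> t * wave (- t) z) has_field_derivative \<phi> t * (2 * of_real pi * \<i> * of_real (- t) * wave (- t) z)) (at z within UNIV)" for z t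
      by (intro DERIV_cmult wave_deriv)
    show "(\<lambda>t. \<phi> t * wave (- t) z) integrable_on cbox (-L) L" for z
      by (intro integrable_continuous continuous_on_subset[OF cont_integrand]) auto
    have "continuous_on (UNIV \<times> cbox (-L) L) (\<lambda>p. \<phi> (snd p))"
      by (rule continuous_on_compose2[OF cont]) (auto intro: continuous_intros)
    then show "continuous_on (UNIV \<times> cbox (-L) L) (\<lambda>(z, t). \<phi> t * (2 * of_real pi * \<i> * of_real (- t) * wave (- t) z))"
      unfolding wave_def case_prod_unfold by (intro continuous_intros)
  qed auto
  then show ?thesis by (simp add: fourier_ext_eq[abs_def])
qed

lemma fourier_ext_bounded:
  obtains C where "\<And>z. \<bar>Im z\<bar> \<le> Y \<Longrightarrow> norm (fourier_ext \<phi> z) \<le> C"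
proof -
  have "bounded (\<phi> ` {-L..L})"
    by (intro compact_imp_bounded compact_continuous_image continuous_on_subset[OF cont]) auto
  then obtain B where B: "\<And>t. t \<in> {-L..L} \<Longrightarrow> norm (\<phi> t) \<le> B" unfolding bounded_iff by blast
  have "norm (fourier_ext \<phi> z) \<le> B * exp (2 * pi * L * Y) * (L - - L)" if "\<bar>Im z\<bar> \<le> Y" for z
    unfolding fourier_ext_eq
  proof (rule integral_bound)
    fix t assume t: "t \<in> {-L..L}"
    then have "norm (wave (- t) z) \<le> exp (2 * pi * L * Y)" by (intro norm_wave_le that) auto
    moreover have "0 \<le> B" using B[OF t] norm_ge_zero order_trans by blast
    ultimately show "norm (\<phi> t * wave (- t) z) \<le> B * exp (2 * pi * L * Y)"
      using B[OF t] by (simp add: norm_mult mult_mono)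
  qed (use L0 in \<open>auto intro: continuous_on_subset[OF cont_integrand]\<close>)
  with that show ?thesis by blast
qed

lemma fourier_ext_derivative:
  assumes deriv: "\<And>t. (\<phi> has_vector_derivative \<phi>' t) (at t)" and cont': "compactly_supported \<phi>' L"
  shows "fourier_ext \<phi>' z = 2 * of_real pi * \<i> * z * fourier_ext \<phi> z"
proof -
  interpret d: compactly_supported \<phi>' L by (rule cont')
  have "((\<lambda>t. \<phi>' t * wave (- t) z + \<phi> t * (- (2 * of_real pi * \<i> * z) * wave (- t) z)) has_integral
      (\<phi> L * wave (- L) z - \<phi> (- L) * wave (- (- L)) z)) {-L..L}"
  proof (rule fundamental_theorem_of_calculus)
    fix t
    have "((\<lambda>t. wave (- t) z) has_vector_derivative - (2 * of_real pi * \<i> * z) * wave (- t) z) (at t)"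
    proof -
      have "((\<lambda>u. exp (- (2 * of_real pi * \<i> * z) * u)) has_field_derivative
          exp (- (2 * of_real pi * \<i> * z) * of_real t) * - (2 * of_real pi * \<i> * z)) (at (of_real t))"
        by (auto intro!: derivative_eq_intros)
      from has_vector_derivative_real_field[OF this] show ?thesis
        by (simp add: wave_def mult_ac)
    qed
    from has_vector_derivative_at_within[OF has_vector_derivative_mult[OF deriv[of t] this]]
    show "((\<lambda>t. \<phi> t * wave (- t) z) has_vector_derivative
        \<phi>' t * wave (- t) z + \<phi> t * (- (2 * of_real pi * \<i> * z) * wave (- t) z)) (at t within {-L..L})"
      by (metis add.commute)
  qed (use L0 in auto)
  moreover have "((\<lambda>t. \<phi>' t * wave (- t) z + - (2 * of_real pi * \<i> * z) * (\<phi> t * wave (- t) z)) has_integral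
      (fourier_ext \<phi>' z + - (2 * of_real pi * \<i> * z) * fourier_ext \<phi> z)) {-L..L}"
    unfolding fourier_ext_eq d.fourier_ext_eq
    by (intro has_integral_add has_integral_mult_right integrable_integral integrable_continuous_interval
        continuous_on_subset[OF cont_integrand] continuous_on_subset[OF d.cont_integrand]) auto
  ultimately have "fourier_ext \<phi>' z + - (2 * of_real pi * \<i> * z) * fourier_ext \<phi> z
      = \<phi> L * wave (- L) z - \<phi> (- L) * wave (- (- L)) z"
    by (intro has_integral_unique) (simp_all add: mult_ac)
  then show ?thesis using supp[of L] supp[of "- L"] L0 by simp
qed

text \<open>Moving the line to height \<open>s\<close> multiplies \<open>\<phi>\<close> by the real exponential
  \<open>wave (- t) (\<i> * s)\<close>, which keeps it continuous with compact support.\<close>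

lemma fourier_inversion_on_line:
  assumes "integrable lborel (\<lambda>x. fourier_ext \<phi> (Complex x s))"
  shows "(LINT x|lborel. fourier_ext \<phi> (Complex x s) * wave l (of_real x)) = \<phi> l * wave (- l) (\<i> * of_real s)"
proof -
  have "Complex x s = of_real x + \<i> * of_real s" for x by (simp add: complex_eq_iff)
  then have eq: "fourier_ext \<phi> (Complex x s) = (LINT t|lborel. (\<phi> t * wave (- t) (\<i> * of_real s)) * wave (- t) (of_real x))" for x
    by (simp add: fourier_ext_def wave_add mult_ac)
  show ?thesis
    using assms unfolding eq
    by (intro fourier_inversion_compact_support[of _ L] cont_integrand) (auto intro: supp)
qed

end

lemma vderiv_0 [simp]: "vderiv 0 \<phi> = \<phi>"
  by (simp add: vderiv_def)

lemma vderiv_has_vector_derivative: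
  assumes "smooth \<phi>"
  shows "(vderiv n \<phi> has_vector_derivative vderiv (Suc n) \<phi> x) (at x)"
  using assms by (simp add: smooth_def vderiv_def vector_derivative_works)

lemma smooth_continuous_on: "smooth \<phi> \<Longrightarrow> continuous_on UNIV (vderiv n \<phi>)"
  by (simp add: smooth_def continuous_on_eq_continuous_at differentiable_imp_continuous_within)

lemma test_function_compactly_supported:
  assumes "\<phi> \<in> test_functions"
  obtains L where "\<And>n. compactly_supported (vderiv n \<phi>) L"
proof -
  have sm: "smooth \<phi>" and "bounded {x. \<phi> x \<noteq> 0}"
    using assms compact_imp_bounded bounded_subset closure_subset
    unfolding test_functions_def by blast+
  then obtain B where "\<And>x. \<phi> x \<noteq> 0 \<Longrightarrow> \<bar>x\<bar> \<le> B" by (auto simp: bounded_iff)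
  then have B: "\<phi> x = 0" if "\<bar>B\<bar> < \<bar>x\<bar>" for x using that by force
  have "vderiv n \<phi> x = 0" if "\<bar>B\<bar> < \<bar>x\<bar>" for n x
    using that
  proof (induction n arbitrary: x)
    case (Suc n)
    have "open {x. \<bar>B\<bar> < \<bar>x\<bar>}" by (intro open_Collect_less continuous_intros)
    moreover have "((\<lambda>_. 0) has_vector_derivative 0) (at x)" by simp
    ultimately have "(vderiv n \<phi> has_vector_derivative 0) (at x)"
      using Suc by (rule_tac has_vector_derivative_transform_within_open[where S = "{x. \<bar>B\<bar> < \<bar>x\<bar>}" and f = "\<lambda>_. 0"]) auto
    with vderiv_has_vector_derivative[OF sm, of n x] show ?case
      using vector_derivative_unique_at by blast
  qed (simp add: B)
  then have "compactly_supported (vderiv n \<phi>) (\<bar>B\<bar> + 1)" for n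
    by unfold_locales (auto intro: smooth_continuous_on sm)
  with that show ?thesis by blast
qed

text \<open>Two integrations by parts; the second derivative suffices because only
  integrability along lines is needed.\<close>

lemma fourier_ext_decay:
  assumes "\<phi> \<in> test_functions"
  obtains C where "\<And>z. \<bar>Im z\<bar> \<le> Y \<Longrightarrow> norm (fourier_ext \<phi> z) \<le> C / (1 + (Re z)\<^sup>2)"
proof -
  have sm: "smooth \<phi>" using assms by (simp add: test_functions_def)
  obtain L where L: "\<And>n. compactly_supported (vderiv n \<phi>) L"
    using test_function_compactly_supported[OF assms] by blast
  interpret c0: compactly_supported \<phi> L using L[of 0] by simp
  interpret c1: compactly_supported "vderiv 1 \<phi>" L by (rule L)
  interpret c2: compactly_supported "vderiv 2 \<phi>" L by (rule L)
  obtain C0 where C0: "\<And>z. \<bar>Im z\<bar> \<le> Y \<Longrightarrow> norm (fourier_ext \<phi> z) \<le> C0" using c0.fourier_ext_bounded by blast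
  obtain C2 where C2: "\<And>z. \<bar>Im z\<bar> \<le> Y \<Longrightarrow> norm (fourier_ext (vderiv 2 \<phi>) z) \<le> C2" using c2.fourier_ext_bounded by blast
  have "norm (fourier_ext \<phi> z) \<le> (C0 + C2) / (1 + (Re z)\<^sup>2)" if "\<bar>Im z\<bar> \<le> Y" for z
  proof -
    have "fourier_ext (vderiv 2 \<phi>) z = (2 * of_real pi * \<i> * z) * ((2 * of_real pi * \<i> * z) * fourier_ext \<phi> z)"
      using c0.fourier_ext_derivative[OF _ L[of 1]] c1.fourier_ext_derivative[OF _ L[of 2]]
        vderiv_has_vector_derivative[OF sm, of 0] vderiv_has_vector_derivative[OF sm, of 1]
      by (simp add: numeral_2_eq_2)
    then have "norm (fourier_ext (vderiv 2 \<phi>) z) = (2 * pi * norm z)\<^sup>2 * norm (fourier_ext \<phi> z)"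
      by (simp add: norm_mult power2_eq_square)
    moreover have "(Re z)\<^sup>2 \<le> (2 * pi * norm z)\<^sup>2"
    proof -
      have "\<bar>Re z\<bar> \<le> 1 * norm z" using abs_Re_le_cmod[of z] by simp
      also have "\<dots> \<le> (2 * pi) * norm z" using pi_gt3 by (intro mult_right_mono) auto
      finally show ?thesis using power_mono[of "\<bar>Re z\<bar>" _ 2] by fastforce
    qed
    ultimately have "(Re z)\<^sup>2 * norm (fourier_ext \<phi> z) \<le> C2"
      using C2[OF that] mult_right_mono[of "(Re z)\<^sup>2" "(2 * pi * norm z)\<^sup>2" "norm (fourier_ext \<phi> z)"] by simp
    then have "norm (fourier_ext \<phi> z) * (1 + (Re z)\<^sup>2) \<le> C0 + C2"
      using C0[OF that] by (simp add: algebra_simps)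
    moreover have "0 < 1 + (Re z)\<^sup>2" by (simp add: add_pos_nonneg)
    ultimately show ?thesis by (simp add: pos_le_divide_eq)
  qed
  with that show ?thesis by blast
qed

lemma fourier_ext_integrable_on_line:
  assumes "\<phi> \<in> test_functions"
  shows "integrable lborel (\<lambda>x. fourier_ext \<phi> (Complex x s))"
proof -
  obtain C where C: "\<And>z. \<bar>Im z\<bar> \<le> \<bar>s\<bar> \<Longrightarrow> norm (fourier_ext \<phi> z) \<le> C / (1 + (Re z)\<^sup>2)"
    using fourier_ext_decay[OF assms] by blast
  obtain L where "compactly_supported (vderiv 0 \<phi>) L"
    using test_function_compactly_supported[OF assms] by blast
  then have "continuous_on UNIV (fourier_ext \<phi>)"
    using compactly_supported.fourier_ext_holomorphic holomorphic_on_imp_continuous_on by fastforce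
  then have "continuous_on UNIV (\<lambda>x. fourier_ext \<phi> (Complex x s))"
    unfolding Complex_eq by (rule continuous_on_compose2) (auto intro!: continuous_intros)
  then have m: "(\<lambda>x. fourier_ext \<phi> (Complex x s)) \<in> borel_measurable lborel"
    by (simp add: borel_measurable_continuous_onI)
  show ?thesis
  proof (rule Bochner_Integration.integrable_bound[OF integrable_inverse_square[of C] m])
    show "AE x in lborel. norm (fourier_ext \<phi> (Complex x s)) \<le> norm (C / (1 + x\<^sup>2))"
    proof (rule AE_I2)
      fix x show "norm (fourier_ext \<phi> (Complex x s)) \<le> norm (C / (1 + x\<^sup>2))"
        using C[of "Complex x s"] divide_right_mono[OF abs_ge_self[of C], of "1 + x\<^sup>2"] by simp
    qed
  qed
qed

text \<open>Pairing with a series of waves samples \<open>\<phi>\<close> at the frequencies: inversion applies to each term, and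
  absolute convergence allows termwise integration.\<close>

lemma fourier_ext_pairing:
  assumes \<phi>: "\<phi> \<in> test_functions" and b: "summable (\<lambda>k::nat. norm (b k))"
  shows "integrable lborel (\<lambda>x. fourier_ext \<phi> (Complex x s) * (\<Sum>k. b k * wave (l k) (of_real x)))"
    and "(\<lambda>k. b k * wave (- l k) (\<i> * of_real s) * \<phi> (l k)) sums
      (LINT x|lborel. fourier_ext \<phi> (Complex x s) * (\<Sum>k. b k * wave (l k) (of_real x)))"
proof -
  let ?G = "\<lambda>x. fourier_ext \<phi> (Complex x s)"
  have Gi: "integrable lborel ?G" by (rule fourier_ext_integrable_on_line[OF \<phi>])
  have Gm: "?G \<in> borel_measurable lborel" by (rule borel_measurable_integrable[OF Gi])
  define a where "a k x = ?G x * (b k * wave (l k) (of_real x))" for k x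
  have na: "norm (a k x) = norm (b k) * norm (?G x)" for k x by (simp add: a_def norm_mult)
  have ai: "integrable lborel (a k)" for k
  proof (rule Bochner_Integration.integrable_bound)
    show "integrable lborel (\<lambda>x. b k * ?G x)" using Gi by simp
    show "a k \<in> borel_measurable lborel" unfolding a_def using Gm by measurable
    show "AE x in lborel. norm (a k x) \<le> norm (b k * ?G x)" by (simp add: na norm_mult)
  qed
  have s1: "AE x in lborel. summable (\<lambda>k. norm (a k x))"
    unfolding na by (intro AE_I2 summable_mult2 b)
  have s2: "summable (\<lambda>k. LINT x|lborel. norm (a k x))"
    unfolding na by (simp add: summable_mult2 b)
  have sw: "(\<Sum>k. a k x) = ?G x * (\<Sum>k. b k * wave (l k) (of_real x))" for x
    unfolding a_def by (rule suminf_mult, rule summable_norm_cancel) (simp add: norm_mult b)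
  show "integrable lborel (\<lambda>x. ?G x * (\<Sum>k. b k * wave (l k) (of_real x)))"
    using integrable_suminf[OF ai s1 s2] by (simp add: sw)
  obtain L where "compactly_supported (vderiv 0 \<phi>) L"
    using test_function_compactly_supported[OF \<phi>] by blast
  then interpret compactly_supported \<phi> L by simp
  have "integral\<^sup>L lborel (a k) = b k * wave (- l k) (\<i> * of_real s) * \<phi> (l k)" for k
  proof -
    have "a k = (\<lambda>x. b k * (?G x * wave (l k) (of_real x)))" by (auto simp: a_def mult_ac)
    then show ?thesis using fourier_inversion_on_line[OF Gi, of "l k"] by (simp add: mult_ac)
  qed
  then show "(\<lambda>k. b k * wave (- l k) (\<i> * of_real s) * \<phi> (l k)) sums
      (LINT x|lborel. ?G x * (\<Sum>k. b k * wave (l k) (of_real x)))"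
    using sums_integral[OF ai s1 s2] by (simp add: sw)
qed

section \<open>Tempered measures and the measure of zeros\<close>

lemma schwartz_seminorm_bound:
  assumes "bounded (range (\<lambda>x. x ^ 0 *\<^sub>R g x))" "bounded (range (\<lambda>x. x ^ 2 *\<^sub>R g x))"
  shows "norm (g x) \<le> (schwartz_seminorm 0 0 g + schwartz_seminorm 2 0 g) / (1 + x\<^sup>2)"
proof -
  have le: "norm (x ^ k *\<^sub>R g x) \<le> schwartz_seminorm k 0 g" if b: "bounded (range (\<lambda>x. x ^ k *\<^sub>R g x))" for k
  proof -
    have "bdd_above (range (\<lambda>x. norm (x ^ k *\<^sub>R g x)))"
      by (rule bounded_imp_bdd_above) (use b in \<open>simp only: bounded_norm_comp\<close>)
    then show ?thesis unfolding schwartz_seminorm_def vderiv_0 by (rule cSUP_upper[OF UNIV_I])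
  qed
  have "norm (g x) * (1 + x\<^sup>2) \<le> schwartz_seminorm 0 0 g + schwartz_seminorm 2 0 g"
    using le[OF assms(1)] le[OF assms(2)] by (simp add: algebra_simps)
  moreover have "0 < 1 + x\<^sup>2" by (simp add: add_pos_nonneg)
  ultimately show ?thesis by (simp add: pos_le_divide_eq)
qed

lemma schwartz_bounded:
  assumes "\<phi> \<in> schwartz"
  shows "bounded (range (\<lambda>x. x ^ k *\<^sub>R \<phi> x))"
proof -
  have "bounded (range (\<lambda>x. x ^ k *\<^sub>R vderiv 0 \<phi> x))" using assms unfolding schwartz_def by blast
  then show ?thesis by simp
qed

lemma schwartz_bounded_diff:
  assumes "\<phi> \<in> schwartz" "\<psi> \<in> schwartz"
  shows "bounded (range (\<lambda>x. x ^ k *\<^sub>R (\<psi> x - \<phi> x)))"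
  using bounded_minus_comp[OF schwartz_bounded[OF assms(2), of k] schwartz_bounded[OF assms(1), of k]]
  by (simp add: scaleR_diff_right)

lemma topspace_schwartz: "topspace schwartz_topology = schwartz"
  unfolding schwartz_topology_def topology_generated_by_topspace
proof (intro equalityI subsetI)
  fix \<phi> assume "\<phi> \<in> schwartz"
  then have "\<phi> \<in> {\<psi> \<in> schwartz. schwartz_seminorm 0 0 (\<lambda>x. \<psi> x - \<phi> x) < 1}"
    by (simp add: schwartz_seminorm_def)
  moreover have "{\<psi> \<in> schwartz. schwartz_seminorm 0 0 (\<lambda>x. \<psi> x - \<phi> x) < 1} \<in>
     {{\<psi> \<in> schwartz. schwartz_seminorm k n (\<lambda>x. \<psi> x - \<phi> x) < e} | k n \<phi> e. \<phi> \<in> schwartz \<and> 0 < e}"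
    using \<open>\<phi> \<in> schwartz\<close> zero_less_one by blast
  ultimately show "\<phi> \<in> \<Union> {{\<psi> \<in> schwartz. schwartz_seminorm k n (\<lambda>x. \<psi> x - \<phi> x) < e} | k n \<phi> e. \<phi> \<in> schwartz \<and> 0 < e}"
    by (rule UnionI[rotated])
qed blast

text \<open>Integrability of \<open>1 / (1 + x\<^sup>2)\<close> bounds the functional by the two seminorms without derivatives, of
  weights \<open>0\<close> and \<open>2\<close>, and hence makes it continuous.\<close>

lemma tempered_measureI:
  assumes sets [measurable_cong]: "sets \<mu> = sets borel" and int: "integrable \<mu> (\<lambda>x::real. 1 / (1 + x\<^sup>2))"
  shows "tempered_measure \<mu>"
proof -
  let ?u = "measure_distribution \<mu>"
  define I where "I = integral\<^sup>L \<mu> (\<lambda>x. 1 / (1 + x\<^sup>2))"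
  have I0: "0 \<le> I" unfolding I_def by (intro integral_nonneg_AE AE_I2) (simp add: add_nonneg_nonneg)
  have int': "integrable \<mu> (\<lambda>x. c / (1 + x\<^sup>2))" for c :: real
    using integrable_mult_right[OF int, of c] by simp
  have sm: "\<phi> \<in> borel_measurable \<mu>" if "\<phi> \<in> schwartz" for \<phi>
  proof -
    have "continuous_on UNIV (vderiv 0 \<phi>)" using that by (intro smooth_continuous_on) (simp add: schwartz_def)
    then have "\<phi> \<in> borel_measurable borel" by (simp add: borel_measurable_continuous_onI)
    then show ?thesis using measurable_cong_sets[OF sets refl] by blast
  qed
  have bnd: "integrable \<mu> g" "norm (integral\<^sup>L \<mu> g) \<le> (schwartz_seminorm 0 0 g + schwartz_seminorm 2 0 g) * I"
    if "g \<in> borel_measurable \<mu>" "\<And>k. bounded (range (\<lambda>x. x ^ k *\<^sub>R g x))" for g :: "real \<Rightarrow> complex"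
  proof -
    let ?S = "schwartz_seminorm 0 0 g + schwartz_seminorm 2 0 g"
    have le: "norm (g x) \<le> ?S / (1 + x\<^sup>2)" for x by (rule schwartz_seminorm_bound) (rule that(2))+
    show "integrable \<mu> g"
    proof (rule Bochner_Integration.integrable_bound[OF int'[of ?S] that(1)])
      show "AE x in \<mu>. norm (g x) \<le> norm (?S / (1 + x\<^sup>2))"
        using le by (intro AE_I2) (metis order_trans abs_ge_self real_norm_def)
    qed
    have "norm (integral\<^sup>L \<mu> g) \<le> integral\<^sup>L \<mu> (\<lambda>x. ?S / (1 + x\<^sup>2))"
      by (rule Bochner_Integration.integral_norm_bound_integral[OF \<open>integrable \<mu> g\<close> int']) (rule le)
    also have "\<dots> = ?S * I" unfolding I_def by (subst integral_mult_right_zero[symmetric]) simp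
    finally show "norm (integral\<^sup>L \<mu> g) \<le> ?S * I" .
  qed
  have ints: "integrable \<mu> \<phi>" if "\<phi> \<in> schwartz" for \<phi>
    by (rule bnd(1)[OF sm[OF that]]) (rule schwartz_bounded[OF that])
  have "continuous_map schwartz_topology euclidean ?u"
    unfolding continuous_map_def
  proof (intro conjI allI impI)
    fix U :: "complex set" assume "openin euclidean U"
    then have "open U" by simp
    let ?P = "{\<phi> \<in> topspace schwartz_topology. ?u \<phi> \<in> U}"
    show "openin schwartz_topology ?P"
    proof (subst openin_subopen, rule ballI)
      fix \<phi> assume "\<phi> \<in> ?P"
      then have \<phi>: "\<phi> \<in> schwartz" "?u \<phi> \<in> U" by (auto simp: topspace_schwartz)
      obtain e where e: "0 < e" "ball (?u \<phi>) e \<subseteq> U" using \<open>open U\<close> \<phi>(2) open_contains_ball by blast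
      define d where "d = e / (I + 1) / 2"
      have "0 < d" using e(1) I0 by (simp add: d_def)
      let ?N = "\<lambda>k. {\<psi> \<in> schwartz. schwartz_seminorm k 0 (\<lambda>x. \<psi> x - \<phi> x) < d}"
      have op: "openin schwartz_topology (?N k)" for k
        unfolding schwartz_topology_def by (rule topology_generated_by_Basis) (use \<phi>(1) \<open>0 < d\<close> in blast)
      have mem: "\<phi> \<in> ?N k" for k using \<phi>(1) \<open>0 < d\<close> by (simp add: schwartz_seminorm_def)
      have "?u \<psi> \<in> U" if \<psi>: "\<psi> \<in> ?N 0 \<inter> ?N 2" for \<psi>
      proof -
        have "norm (integral\<^sup>L \<mu> (\<lambda>x. \<psi> x - \<phi> x)) \<le>
            (schwartz_seminorm 0 0 (\<lambda>x. \<psi> x - \<phi> x) + schwartz_seminorm 2 0 (\<lambda>x. \<psi> x - \<phi> x)) * I"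
          using \<psi> \<phi>(1) by (intro bnd(2) schwartz_bounded_diff borel_measurable_diff sm) auto
        also have "\<dots> \<le> (d + d) * I" using \<psi> I0 by (intro mult_right_mono add_mono) auto
        also have "d + d = e / (I + 1)" unfolding d_def by (rule field_sum_of_halves)
        also have "e / (I + 1) * I = e * (I / (I + 1))" by simp
        also have "\<dots> < e * 1" using e(1) I0 by (intro mult_strict_left_mono) (auto simp: divide_less_eq_1)
        finally have "norm (?u \<psi> - ?u \<phi>) < e"
          using ints[of \<psi>] ints[OF \<phi>(1)] \<psi> by (simp add: measure_distribution_def)
        then show ?thesis using e(2) by (auto simp: dist_norm norm_minus_commute)
      qed
      then have "?N 0 \<inter> ?N 2 \<subseteq> ?P" by (auto simp: topspace_schwartz)
      then show "\<exists>T. openin schwartz_topology T \<and> \<phi> \<in> T \<and> T \<subseteq> ?P"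
        using op mem by (intro exI[of _ "?N 0 \<inter> ?N 2"]) (auto intro: openin_Int)
    qed
  qed auto
  then show ?thesis
    unfolding tempered_measure_def tempered_distribution_def
    using sets ints by (auto simp: measure_distribution_def)
qed

text \<open>Cutting the line into the shells \<open>n \<le> \<bar>x\<bar> \<le> n + 1\<close>, each covered by two unit intervals,
  compares the integral with \<open>\<Sum>n. 1 / (1 + n\<^sup>2)\<close>.\<close>

lemma integrable_inverse_square_unit_mass:
  fixes \<mu> :: "real measure"
  assumes sets [measurable_cong]: "sets \<mu> = sets borel" and mass: "\<And>t. emeasure \<mu> {t..t+1} \<le> ennreal C" and "0 \<le> C"
  shows "integrable \<mu> (\<lambda>x. 1 / (1 + x\<^sup>2))"
proof -
  let ?A = "\<lambda>n::nat. {x::real. real n \<le> \<bar>x\<bar> \<and> \<bar>x\<bar> \<le> real n + 1}"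
  let ?c = "\<lambda>n::nat. 1 / (1 + (real n)\<^sup>2)"
  have em: "emeasure \<mu> (?A n) \<le> ennreal (2 * C)" for n
  proof -
    have "emeasure \<mu> (?A n) \<le> emeasure \<mu> ({real n..real n + 1} \<union> {- real n - 1..(- real n - 1) + 1})"
      by (rule emeasure_mono) auto
    also have "\<dots> \<le> emeasure \<mu> {real n..real n + 1} + emeasure \<mu> {- real n - 1..(- real n - 1) + 1}"
      by (rule emeasure_subadditive) auto
    also have "\<dots> \<le> ennreal C + ennreal C" by (intro add_mono mass)
    also have "\<dots> = ennreal (2 * C)" using \<open>0 \<le> C\<close> by (simp flip: ennreal_plus)
    finally show ?thesis .
  qed
  have sc: "summable ?c"
  proof (rule summable_comparison_test'[OF summable_mult[OF inverse_power_summable[of 2], of 1]])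
    fix n :: nat assume "1 \<le> n"
    then have "inverse (1 + (real n)\<^sup>2) \<le> inverse ((real n)\<^sup>2)" by (intro le_imp_inverse_le) auto
    then show "norm (?c n) \<le> 1 * inverse (real n ^ 2)"
      by (simp add: divide_inverse)
  qed auto
  have "(\<integral>\<^sup>+x. ennreal (norm (1 / (1 + x\<^sup>2))) \<partial>\<mu>) \<le> (\<integral>\<^sup>+x. (\<Sum>n. ennreal (?c n) * indicator (?A n) x) \<partial>\<mu>)"
  proof (rule nn_integral_mono)
    fix x :: real
    define n where "n = nat \<lfloor>\<bar>x\<bar>\<rfloor>"
    have n: "real n \<le> \<bar>x\<bar>" "\<bar>x\<bar> \<le> real n + 1" unfolding n_def by linarith+
    then have "(real n)\<^sup>2 \<le> x\<^sup>2" using power_mono[of "real n" "\<bar>x\<bar>" 2] by simp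
    then have "norm (1 / (1 + x\<^sup>2)) \<le> ?c n"
      by (auto simp: add_nonneg_nonneg add_pos_nonneg intro!: divide_left_mono mult_pos_pos)
    then have "ennreal (norm (1 / (1 + x\<^sup>2))) \<le> ennreal (?c n) * indicator (?A n) x"
      using n by (simp add: ennreal_leI)
    also have "g n \<le> (\<Sum>k. g k)" for g :: "nat \<Rightarrow> ennreal"
      using sum_le_suminf[of g "{n}"] by simp
    then have "ennreal (?c n) * indicator (?A n) x \<le> (\<Sum>k. ennreal (?c k) * indicator (?A k) x)" .
    finally show "ennreal (norm (1 / (1 + x\<^sup>2))) \<le> (\<Sum>k. ennreal (?c k) * indicator (?A k) x)" .
  qed
  also have "\<dots> = (\<Sum>n. ennreal (?c n) * emeasure \<mu> (?A n))"
    by (subst nn_integral_suminf) (auto simp: nn_integral_cmult_indicator)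
  also have "\<dots> \<le> (\<Sum>n. ennreal (?c n) * ennreal (2 * C))"
    by (intro suminf_le mult_left_mono em) auto
  also have "\<dots> = (\<Sum>n. ennreal (?c n * (2 * C)))"
    using \<open>0 \<le> C\<close> by (intro suminf_cong ennreal_mult[symmetric]) auto
  also have "\<dots> = ennreal (\<Sum>n. ?c n * (2 * C))"
    using \<open>0 \<le> C\<close> by (intro suminf_ennreal2 summable_mult2 sc) (auto simp: add_nonneg_nonneg)
  also have "\<dots> < \<infinity>" by simp
  finally show ?thesis by (intro integrableI_bounded) auto
qed

lemma sets_zero_measure [simp, measurable_cong]: "sets (zero_measure f) = sets borel"
  by (simp add: zero_measure_def)

lemma emeasure_zero_measure:
  assumes "A \<in> sets borel" "finite {x \<in> A. f (of_real x) = 0}"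
  shows "emeasure (zero_measure f) A = (\<Sum>x\<in>{x \<in> A. f (of_real x) = 0}. of_nat (nat (zorder f (of_real x))))"
proof -
  let ?M = "point_measure {x. f (of_real x) = 0} (\<lambda>x. of_nat (nat (zorder f (of_real x))) :: ennreal)"
  have "emeasure (zero_measure f) A = emeasure ?M ((\<lambda>x. x) -` A \<inter> space ?M)"
    unfolding zero_measure_def by (rule emeasure_distr) (use assms in \<open>auto simp: point_measure_def\<close>)
  also have "(\<lambda>x. x) -` A \<inter> space ?M = {x \<in> A. f (of_real x) = 0}" by (auto simp: space_point_measure)
  also have "emeasure ?M {x \<in> A. f (of_real x) = 0} = (\<Sum>x\<in>{x \<in> A. f (of_real x) = 0}. of_nat (nat (zorder f (of_real x))))"
    using assms by (intro emeasure_point_measure_finite2) auto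
  finally show ?thesis .
qed

lemma integral_zero_measure:
  fixes h :: "real \<Rightarrow> complex"
  assumes [measurable]: "A \<in> sets borel" "h \<in> borel_measurable borel" and fin: "finite {x \<in> A. f (of_real x) = 0}"
  shows "(LINT x|zero_measure f. indicator A x *\<^sub>R h x)
    = (\<Sum>x\<in>{x \<in> A. f (of_real x) = 0}. of_nat (nat (zorder f (of_real x))) * h x)"
proof -
  let ?Z = "{x. f (of_real x) = 0}"
  let ?m = "\<lambda>x. real (nat (zorder f (of_real x)))"
  let ?M = "point_measure ?Z (\<lambda>x. of_nat (nat (zorder f (of_real x))) :: ennreal)"
  have M: "?M = density (count_space ?Z) (\<lambda>x. ennreal (?m x))"
    by (simp add: point_measure_def ennreal_of_nat_eq_real_of_nat)
  have "(LINT x|zero_measure f. indicator A x *\<^sub>R h x) = (LINT x|?M. indicator A x *\<^sub>R h x)"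
    unfolding zero_measure_def by (rule integral_distr) (auto simp: point_measure_def)
  also have "\<dots> = (LINT x|count_space ?Z. ?m x *\<^sub>R (indicator A x *\<^sub>R h x))"
    unfolding M by (rule integral_density) auto
  also have "\<dots> = (\<Sum>x | x \<in> ?Z \<and> ?m x *\<^sub>R (indicator A x *\<^sub>R h x) \<noteq> 0. ?m x *\<^sub>R (indicator A x *\<^sub>R h x))"
    by (rule lebesgue_integral_count_space_finite_support, rule finite_subset[OF _ fin]) (auto simp: indicator_def split: if_splits)
  also have "\<dots> = (\<Sum>x\<in>{x \<in> A. f (of_real x) = 0}. ?m x *\<^sub>R (indicator A x *\<^sub>R h x))"
    by (rule sum.mono_neutral_left[OF fin]) (auto simp: indicator_def split: if_splits)
  also have "\<dots> = (\<Sum>x\<in>{x \<in> A. f (of_real x) = 0}. of_nat (nat (zorder f (of_real x))) * h x)"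
    by (rule sum.cong) (auto simp: scaleR_conv_of_real)
  finally show ?thesis .
qed

section \<open>Residues on rectangles and pure point measures\<close>

lemma contour_integral_horizontal:
  assumes "a < b" and cont: "continuous_on (closed_segment (Complex a s) (Complex b s)) g"
  shows "contour_integral (linepath (Complex a s) (Complex b s)) g = integral {a..b} (\<lambda>x. g (Complex x s))"
proof -
  have "(g has_contour_integral contour_integral (linepath (Complex a s) (Complex b s)) g)
      (linepath (Complex a s) (Complex b s))"
    using cont by (intro has_contour_integral_integral contour_integrable_continuous_linepath)
  moreover have "linepath (Complex a s) (Complex b s) x = linepath (of_real a) (of_real b) x + \<i> * of_real s" for x
    by (simp add: linepath_def complex_eq_iff algebra_simps)
  moreover have "Complex b s - Complex a s = of_real b - of_real a" by (simp add: complex_eq_iff)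
  ultimately have "((\<lambda>z. g (z + \<i> * of_real s)) has_contour_integral
      contour_integral (linepath (Complex a s) (Complex b s)) g) (linepath (of_real a) (of_real b))"
    by (simp add: has_contour_integral_linepath)
  then have "((\<lambda>x. g (of_real x + \<i> * of_real s)) has_integral
      contour_integral (linepath (Complex a s) (Complex b s)) g) {a..b}"
    using \<open>a < b\<close> by (subst (asm) has_contour_integral_linepath_Reals_iff) auto
  moreover have "Complex x s = of_real x + \<i> * of_real s" for x by (simp add: complex_eq_iff)
  ultimately show ?thesis by (simp add: integral_unique)
qed

text \<open>The argument principle with weight \<open>\<Phi>\<close>. The zeros are real, so the horizontal sides never meet
  them and the vertical sides do so at most in their midpoints \<open>a\<close> and \<open>b\<close>. The vertical sides, of length \<open>2 * s\<close>
  each, enter only through the error term.\<close>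

lemma rectangle_zero_sum:
  assumes f_hol: "f holomorphic_on UNIV" and \<Phi>_hol: "\<Phi> holomorphic_on UNIV"
    and real_zeros: "\<And>z. f z = 0 \<Longrightarrow> Im z = 0"
    and "a < b" "0 < s" and fa: "f (of_real a) \<noteq> 0" and fb: "f (of_real b) \<noteq> 0"
    and M: "\<And>x y. x \<in> {a, b} \<Longrightarrow> \<bar>y\<bar> \<le> s \<Longrightarrow> norm (deriv f (Complex x y) * \<Phi> (Complex x y) / f (Complex x y)) \<le> M"
  defines "Z \<equiv> {x. a < x \<and> x < b \<and> f (of_real x) = 0}"
    and "g \<equiv> \<lambda>z. deriv f z * \<Phi> z / f z"
  shows "finite Z"
    and "norm (2 * of_real pi * \<i> * (\<Sum>x\<in>Z. \<Phi> (of_real x) * of_int (zorder f (of_real x)))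
      - (integral {a..b} (\<lambda>x. g (Complex x (- s))) - integral {a..b} (\<lambda>x. g (Complex x s)))) \<le> 4 * s * M"
proof -
  define c1 c2 c3 c4 where "c1 = Complex a (- s)" and "c2 = Complex b (- s)" and "c3 = Complex b s" and "c4 = Complex a s"
  define R where "R = \<bar>a\<bar> + \<bar>b\<bar> + s + 1"
  have box_ball: "cbox c1 c3 \<subseteq> ball 0 R"
  proof
    fix z assume "z \<in> cbox c1 c3"
    then have "\<bar>Re z\<bar> \<le> \<bar>a\<bar> + \<bar>b\<bar>" "\<bar>Im z\<bar> \<le> s" by (auto simp: in_cbox_complex_iff c1_def c3_def)
    then show "z \<in> ball 0 R" using cmod_le[of z] by (simp add: R_def)
  qed
  have fin0: "finite {z \<in> cball 0 R. f z = 0}"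
  proof (cases "f constant_on UNIV")
    case True
    then have "f z \<noteq> 0" for z using fa by (metis UNIV_I constant_on_def)
    then show ?thesis by simp
  next
    case False
    then show ?thesis by (intro holomorphic_compact_finite_zeros[OF f_hol]) auto
  qed
  define P where "P = {z \<in> ball 0 R. f z = 0 \<or> z \<in> {}}"
  have finP: "finite P" by (rule finite_subset[OF _ fin0]) (auto simp: P_def)
  have ZP: "of_real ` Z \<subseteq> P"
  proof
    fix p :: complex assume "p \<in> of_real ` Z"
    then obtain x where x: "p = of_real x" "x \<in> Z" by blast
    then have "\<bar>x\<bar> < R" using \<open>0 < s\<close> by (auto simp: R_def Z_def)
    then show "p \<in> P" using x by (simp add: P_def Z_def)
  qed
  have inj: "inj_on (of_real :: real \<Rightarrow> complex) Z" by (simp add: inj_on_def)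
  show "finite Z" using finite_subset[OF ZP finP] inj finite_imageD by blast
  have nz: "f z \<noteq> 0" if "z \<in> cbox c1 c3 - box c1 c3" for z
  proof
    assume "f z = 0"
    then have "Im z = 0" by (rule real_zeros)
    then have "z = of_real a \<or> z = of_real b"
      using that \<open>0 < s\<close> \<open>a < b\<close> by (auto simp: in_cbox_complex_iff in_box_complex_iff c1_def c3_def complex_eq_iff)
    then show False using fa fb \<open>f z = 0\<close> by blast
  qed
  have g_cont: "continuous_on (cbox c1 c3 - box c1 c3) g"
  proof -
    have "deriv f holomorphic_on UNIV" by (rule holomorphic_deriv[OF f_hol open_UNIV])
    then show ?thesis unfolding g_def
      using f_hol \<Phi>_hol nz
      by (intro holomorphic_on_imp_continuous_on holomorphic_on_divide holomorphic_on_mult)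
         (auto intro: holomorphic_on_subset)
  qed
  have im: "path_image (rectpath c1 c3) = cbox c1 c3 - box c1 c3"
    using \<open>a < b\<close> \<open>0 < s\<close> by (intro path_image_rectpath_cbox_minus_box) (auto simp: c1_def c3_def)
  have rect: "rectpath c1 c3 = linepath c1 c2 +++ linepath c2 c3 +++ linepath c3 c4 +++ linepath c4 c1"
    by (simp add: rectpath_def Let_def c1_def c2_def c3_def c4_def)
  have segs: "closed_segment c1 c2 \<union> closed_segment c2 c3 \<union> closed_segment c3 c4 \<union> closed_segment c4 c1 = cbox c1 c3 - box c1 c3"
    using im unfolding rect by (simp add: path_image_join Un_assoc)
  have c: "continuous_on (closed_segment c1 c2) g" "continuous_on (closed_segment c2 c3) g"
      "continuous_on (closed_segment c3 c4) g" "continuous_on (closed_segment c4 c1) g"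
    using segs by (auto intro!: continuous_on_subset[OF g_cont])
  then have ci: "g contour_integrable_on linepath c1 c2" "g contour_integrable_on linepath c2 c3"
      "g contour_integrable_on linepath c3 c4" "g contour_integrable_on linepath c4 c1"
    by (auto intro: contour_integrable_continuous_linepath)
  have split: "contour_integral (rectpath c1 c3) g = contour_integral (linepath c1 c2) g +
      (contour_integral (linepath c2 c3) g + (contour_integral (linepath c3 c4) g + contour_integral (linepath c4 c1) g))"
    unfolding rect using ci by (simp add: contour_integral_join contour_integrable_join valid_path_join)
  have bot: "contour_integral (linepath c1 c2) g = integral {a..b} (\<lambda>x. g (Complex x (- s)))"
    unfolding c1_def c2_def using c(1) \<open>a < b\<close> by (intro contour_integral_horizontal) (auto simp: c1_def c2_def)
  have top: "contour_integral (linepath c3 c4) g = - integral {a..b} (\<lambda>x. g (Complex x s))"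
  proof -
    have c': "continuous_on (closed_segment c4 c3) g" using c(3) by (simp add: closed_segment_commute)
    have "contour_integral (linepath c3 c4) g = - contour_integral (linepath c4 c3) g"
      using c(3) by (rule contour_integral_reverse_linepath)
    also have "contour_integral (linepath c4 c3) g = integral {a..b} (\<lambda>x. g (Complex x s))"
      unfolding c3_def c4_def using c' \<open>a < b\<close> by (intro contour_integral_horizontal) (auto simp: c3_def c4_def)
    finally show ?thesis .
  qed
  have "norm (g (Complex a 0)) \<le> M" unfolding g_def using M[of a 0] \<open>0 < s\<close> by simp
  then have "0 \<le> M" using norm_ge_zero order_trans by blast
  have vert: "norm (contour_integral (linepath (Complex x y) (Complex x (- y))) g) \<le> M * (2 * s)"
    if x: "x \<in> {a, b}" and y: "\<bar>y\<bar> = s" and ci': "g contour_integrable_on (linepath (Complex x y) (Complex x (- y)))" for x y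
  proof -
    have "norm (contour_integral (linepath (Complex x y) (Complex x (- y))) g) \<le> M * norm (Complex x (- y) - Complex x y)"
    proof (rule contour_integral_bound_linepath[OF ci' \<open>0 \<le> M\<close>])
      fix z assume "z \<in> closed_segment (Complex x y) (Complex x (- y))"
      then have "Re z = x" "\<bar>Im z\<bar> \<le> s"
        using y by (auto simp: closed_segment_same_Re closed_segment_eq_real_ivl split: if_splits)
      then have "z = Complex x (Im z)" "norm (g (Complex x (Im z))) \<le> M"
        using M[OF x, of "Im z"] by (simp_all add: g_def complex_eq_iff)
      then show "norm (g z) \<le> M" by simp
    qed
    also have "norm (Complex x (- y) - Complex x y) = 2 * s" using y \<open>0 < s\<close> by (simp add: cmod_def real_sqrt_mult)
    finally show ?thesis .
  qed
  have V: "norm (contour_integral (linepath c2 c3) g + contour_integral (linepath c4 c1) g) \<le> M * (2 * s) + M * (2 * s)"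
    using vert[of b "- s"] vert[of a s] ci \<open>0 < s\<close>
    by (intro order_trans[OF norm_triangle_ineq] add_mono) (auto simp: c1_def c2_def c3_def c4_def)
  have total: "contour_integral (rectpath c1 c3) g
      = 2 * of_real pi * \<i> * (\<Sum>x\<in>Z. \<Phi> (of_real x) * of_int (zorder f (of_real x)))"
  proof -
    have "contour_integral (rectpath c1 c3) g
        = 2 * pi * \<i> * (\<Sum>p\<in>P. winding_number (rectpath c1 c3) p * \<Phi> p * zorder f p)"
      unfolding g_def P_def
    proof (rule argument_principle)
      show "path_image (rectpath c1 c3) \<subseteq> ball 0 R - {w \<in> ball 0 R. f w = 0 \<or> w \<in> {}}"
        unfolding im using nz box_ball by auto
      show "\<forall>z. z \<notin> ball 0 R \<longrightarrow> winding_number (rectpath c1 c3) z = 0"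
        using box_ball \<open>a < b\<close> \<open>0 < s\<close> by (auto intro!: winding_number_rectpath_outside simp: c1_def c3_def)
      show "finite {w \<in> ball 0 R. f w = 0 \<or> w \<in> {}}" using finP by (simp add: P_def)
    qed (use f_hol \<Phi>_hol in \<open>auto intro: holomorphic_on_subset\<close>)
    also have "(\<Sum>p\<in>P. winding_number (rectpath c1 c3) p * \<Phi> p * zorder f p)
        = (\<Sum>p\<in>of_real ` Z. winding_number (rectpath c1 c3) p * \<Phi> p * zorder f p)"
    proof (rule sum.mono_neutral_right[OF finP ZP], rule ballI)
      fix p assume p: "p \<in> P - of_real ` Z"
      then have fp: "f p = 0" by (simp add: P_def)
      then have "Im p = 0" by (rule real_zeros)
      then have pr: "p = of_real (Re p)" by (simp add: complex_eq_iff)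
      then have "Re p \<notin> Z" using p by (metis DiffD2 imageI)
      moreover have "f (of_real (Re p)) = 0" using fp pr by simp
      moreover from this have "Re p \<noteq> a" "Re p \<noteq> b" using fa fb by auto
      ultimately have "p \<notin> cbox c1 c3"
        by (auto simp: Z_def in_cbox_complex_iff c1_def c3_def)
      then have "winding_number (rectpath c1 c3) p = 0"
        using \<open>a < b\<close> \<open>0 < s\<close> by (intro winding_number_rectpath_outside) (auto simp: c1_def c3_def)
      then show "winding_number (rectpath c1 c3) p * \<Phi> p * zorder f p = 0" by simp
    qed
    also have "\<dots> = (\<Sum>x\<in>Z. winding_number (rectpath c1 c3) (of_real x) * \<Phi> (of_real x) * zorder f (of_real x))"
      by (simp add: sum.reindex[OF inj])
    also have "\<dots> = (\<Sum>x\<in>Z. \<Phi> (of_real x) * of_int (zorder f (of_real x)))"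
    proof (rule sum.cong[OF refl])
      fix x assume "x \<in> Z"
      then have "winding_number (rectpath c1 c3) (of_real x) = 1"
        using \<open>0 < s\<close> by (intro winding_number_rectpath) (auto simp: Z_def in_box_complex_iff c1_def c3_def)
      then show "winding_number (rectpath c1 c3) (of_real x) * \<Phi> (of_real x) * zorder f (of_real x)
          = \<Phi> (of_real x) * of_int (zorder f (of_real x))" by simp
    qed
    finally show ?thesis by simp
  qed
  have eq: "2 * of_real pi * \<i> * (\<Sum>x\<in>Z. \<Phi> (of_real x) * of_int (zorder f (of_real x)))
      - (integral {a..b} (\<lambda>x. g (Complex x (- s))) - integral {a..b} (\<lambda>x. g (Complex x s)))
      = contour_integral (linepath c2 c3) g + contour_integral (linepath c4 c1) g"
    unfolding total[symmetric] split bot top by simp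
  show "norm (2 * of_real pi * \<i> * (\<Sum>x\<in>Z. \<Phi> (of_real x) * of_int (zorder f (of_real x)))
      - (integral {a..b} (\<lambda>x. g (Complex x (- s))) - integral {a..b} (\<lambda>x. g (Complex x s)))) \<le> 4 * s * M"
    unfolding eq using V by (simp add: mult_ac)
qed

text \<open>The points \<open>\<gamma> k\<close> may repeat. The mass at \<open>x\<close> is the sum of \<open>\<beta> k\<close> over the fibre of
  \<open>x\<close>, and local absolute summability justifies summing fibre by fibre.\<close>

lemma pure_point_of_series:
  fixes \<beta> :: "nat \<Rightarrow> complex" and \<gamma> :: "nat \<Rightarrow> real"
  assumes loc: "\<And>R. summable (\<lambda>k. if \<bar>\<gamma> k\<bar> \<le> R then norm (\<beta> k) else 0)"
    and u: "\<And>\<phi>. \<phi> \<in> test_functions \<Longrightarrow> (\<lambda>k. \<beta> k * \<phi> (\<gamma> k)) sums u \<phi>"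
  shows "is_pure_point_measure u"
proof -
  define F where "F x = {k. \<gamma> k = x}" for x
  define b where "b x = infsum \<beta> (F x)" for x
  have bij: "bij_betw (\<lambda>k. (\<gamma> k, k)) {k. \<gamma> k \<in> S} (Sigma (range \<gamma> \<inter> S) F)" for S
    by (auto simp: bij_betw_def inj_on_def F_def image_iff)
  show ?thesis
    unfolding is_pure_point_measure_def
  proof (intro exI[of _ "range \<gamma>"] exI[of _ b] conjI allI impI ballI)
    show "countable (range \<gamma>)" by simp
  next
    fix K :: "real set" assume "compact K"
    then obtain R where R: "\<And>x. x \<in> K \<Longrightarrow> \<bar>x\<bar> \<le> R" using compact_imp_bounded by (fastforce simp: bounded_iff)
    have "(\<lambda>k. if \<bar>\<gamma> k\<bar> \<le> R then norm (\<beta> k) else 0) summable_on UNIV"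
      by (rule norm_summable_imp_summable_on) (use loc[of R] in \<open>simp add: if_distrib[of norm] cong: if_cong\<close>)
    then have "(\<lambda>k. if \<bar>\<gamma> k\<bar> \<le> R then norm (\<beta> k) else 0) summable_on {k. \<gamma> k \<in> K}"
      by (rule summable_on_subset_banach) auto
    then have sK: "(\<lambda>k. norm (\<beta> k)) summable_on {k. \<gamma> k \<in> K}"
      by (rule summable_on_cong[THEN iffD1, rotated]) (use R in auto)
    then have "(\<lambda>p. norm (\<beta> (snd p))) summable_on Sigma (range \<gamma> \<inter> K) F"
      using summable_on_reindex_bij_betw[OF bij[of K], of "\<lambda>p. norm (\<beta> (snd p))"] by simp
    then have "(\<lambda>x. infsum (\<lambda>k. norm (\<beta> k)) (F x)) summable_on (range \<gamma> \<inter> K)"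
      using summable_on_Sigma_banach[of "\<lambda>x k. norm (\<beta> k)"] by (simp add: case_prod_unfold)
    then show "(\<lambda>x. norm (b x)) summable_on (range \<gamma> \<inter> K)"
    proof (rule summable_on_comparison_test)
      fix x assume "x \<in> range \<gamma> \<inter> K"
      then have "(\<lambda>k. norm (\<beta> k)) summable_on F x"
        by (intro summable_on_subset_banach[OF sK]) (auto simp: F_def)
      then show "norm (b x) \<le> infsum (\<lambda>k. norm (\<beta> k)) (F x)"
        unfolding b_def by (rule norm_infsum_bound)
    qed auto
  next
    fix \<phi> assume \<phi>: "\<phi> \<in> test_functions"
    then obtain L where "compactly_supported (vderiv 0 \<phi>) L" using test_function_compactly_supported by blast
    then interpret compactly_supported \<phi> L by simp
    have "bounded (\<phi> ` {-L..L})"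
      by (intro compact_imp_bounded compact_continuous_image continuous_on_subset[OF cont]) auto
    then obtain B where B: "\<And>t. t \<in> {-L..L} \<Longrightarrow> norm (\<phi> t) \<le> B" unfolding bounded_iff by blast
    have "summable (\<lambda>k. norm (\<beta> k * \<phi> (\<gamma> k)))"
    proof (rule summable_comparison_test'[OF summable_mult2[OF loc[of L], of B]])
      fix k
      show "norm (norm (\<beta> k * \<phi> (\<gamma> k))) \<le> (if \<bar>\<gamma> k\<bar> \<le> L then norm (\<beta> k) else 0) * B"
        using B[of "\<gamma> k"] supp[of "\<gamma> k"] by (auto simp: norm_mult abs_le_iff intro: mult_left_mono)
    qed
    then have hs: "((\<lambda>k. \<beta> k * \<phi> (\<gamma> k)) has_sum u \<phi>) UNIV"
      using u[OF \<phi>] by (rule norm_summable_imp_has_sum)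
    have bijU: "bij_betw (\<lambda>k. (\<gamma> k, k)) UNIV (Sigma (range \<gamma>) F)" using bij[of UNIV] by simp
    have "(\<lambda>p. \<beta> (snd p) * \<phi> (fst p)) summable_on Sigma (range \<gamma>) F"
      using summable_on_reindex_bij_betw[OF bijU, of "\<lambda>p. \<beta> (snd p) * \<phi> (fst p)"] has_sum_imp_summable[OF hs] by simp
    then have "infsum (\<lambda>x. infsum (\<lambda>k. \<beta> k * \<phi> x) (F x)) (range \<gamma>) = infsum (\<lambda>p. \<beta> (snd p) * \<phi> (fst p)) (Sigma (range \<gamma>) F)"
      using infsum_Sigma'_banach[of "\<lambda>x k. \<beta> k * \<phi> x"] by (simp add: case_prod_unfold)
    also have "\<dots> = infsum (\<lambda>k. \<beta> k * \<phi> (\<gamma> k)) UNIV"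
      using infsum_reindex_bij_betw[OF bijU, of "\<lambda>p. \<beta> (snd p) * \<phi> (fst p)"] by simp
    also have "\<dots> = u \<phi>" using hs by (rule infsumI)
    finally show "u \<phi> = (\<Sum>\<^sub>\<infinity>x\<in>range \<gamma>. b x * \<phi> x)"
      by (simp add: b_def infsum_cmult_left')
  qed
qed

lemma sums_interleave_complex:
  fixes g h :: "nat \<Rightarrow> complex"
  assumes "g sums x" "h sums y"
  shows "(\<lambda>n. if even n then h (n div 2) else g ((n - 1) div 2)) sums (x + y)"
  using assms sums_if[of "\<lambda>n. Re (g n)" "Re x" "\<lambda>n. Re (h n)" "Re y"] sums_if[of "\<lambda>n. Im (g n)" "Im x" "\<lambda>n. Im (h n)" "Im y"]
  by (simp add: sums_complex_iff if_distrib[of Re] if_distrib[of Im])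

text \<open>The two families of point masses are interleaved into one, as even and odd terms.\<close>

lemma pure_point_of_two_series:
  fixes \<beta> \<beta>' :: "nat \<Rightarrow> complex" and \<gamma> \<gamma>' :: "nat \<Rightarrow> real"
  assumes "\<And>R. summable (\<lambda>k. if \<bar>\<gamma> k\<bar> \<le> R then norm (\<beta> k) else 0)"
    and "\<And>R. summable (\<lambda>k. if \<bar>\<gamma>' k\<bar> \<le> R then norm (\<beta>' k) else 0)"
    and "\<And>\<phi>. \<phi> \<in> test_functions \<Longrightarrow> (\<lambda>k. \<beta> k * \<phi> (\<gamma> k)) sums u \<phi>"
    and "\<And>\<phi>. \<phi> \<in> test_functions \<Longrightarrow> (\<lambda>k. \<beta>' k * \<phi> (\<gamma>' k)) sums u' \<phi>"
  shows "is_pure_point_measure (\<lambda>\<phi>. u \<phi> + u' \<phi>)"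
proof (rule pure_point_of_series)
  let ?\<beta> = "\<lambda>n. if even n then \<beta>' (n div 2) else \<beta> ((n - 1) div 2)"
  let ?\<gamma> = "\<lambda>n. if even n then \<gamma>' (n div 2) else \<gamma> ((n - 1) div 2)"
  show "summable (\<lambda>k. if \<bar>?\<gamma> k\<bar> \<le> R then norm (?\<beta> k) else 0)" for R
  proof -
    have "(\<lambda>k. if \<bar>?\<gamma> k\<bar> \<le> R then norm (?\<beta> k) else 0) =
        (\<lambda>n. if even n then (if \<bar>\<gamma>' (n div 2)\<bar> \<le> R then norm (\<beta>' (n div 2)) else 0)
           else (if \<bar>\<gamma> ((n - 1) div 2)\<bar> \<le> R then norm (\<beta> ((n - 1) div 2)) else 0))"
      by auto
    then show ?thesis using sums_if[OF summable_sums[OF assms(1)[of R]] summable_sums[OF assms(2)[of R]]]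
      by (simp only: sums_summable)
  qed
  show "(\<lambda>k. ?\<beta> k * \<phi> (?\<gamma> k)) sums (u \<phi> + u' \<phi>)" if "\<phi> \<in> test_functions" for \<phi>
  proof -
    have "(\<lambda>k. ?\<beta> k * \<phi> (?\<gamma> k)) = (\<lambda>n. if even n then \<beta>' (n div 2) * \<phi> (\<gamma>' (n div 2))
          else \<beta> ((n - 1) div 2) * \<phi> (\<gamma> ((n - 1) div 2)))" by auto
    then show ?thesis using sums_interleave_complex[OF assms(3)[OF that] assms(4)[OF that]] by simp
  qed
qed

section \<open>The Fourier transform of the measure of zeros\<close>

lemma is_pure_point_measure_cong:
  assumes "\<And>\<phi>. \<phi> \<in> test_functions \<Longrightarrow> u \<phi> = v \<phi>"
  shows "is_pure_point_measure u \<longleftrightarrow> is_pure_point_measure v"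
  using assms unfolding is_pure_point_measure_def by simp

lemma integral_exhaustion:
  fixes h :: "'a \<Rightarrow> complex"
  assumes int: "integrable M h" and sets: "\<And>n. A n \<in> sets M"
    and ex: "\<And>x. \<forall>\<^sub>F n in sequentially. x \<in> A n"
  shows "(\<lambda>n. LINT x|M. indicator (A n) x *\<^sub>R h x) \<longlonglongrightarrow> integral\<^sup>L M h"
proof (rule integral_dominated_convergence[where w = "\<lambda>x. norm (h x)"])
  show "h \<in> borel_measurable M" using int by (rule borel_measurable_integrable)
  then show "(\<lambda>x. indicator (A n) x *\<^sub>R h x) \<in> borel_measurable M" for n
    using sets[of n] by measurable
  show "integrable M (\<lambda>x. norm (h x))" using int by (rule integrable_norm)
  have "(\<lambda>n. indicator (A n) x *\<^sub>R h x) \<longlonglongrightarrow> h x" for x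
    by (rule tendsto_eventually) (use ex[of x] in eventually_elim, simp)
  then show "AE x in M. (\<lambda>n. indicator (A n) x *\<^sub>R h x) \<longlonglongrightarrow> h x" by simp
  show "AE x in M. norm (indicator (A n) x *\<^sub>R h x) \<le> norm (h x)" for n
    by (intro AE_I2) (simp add: indicator_def)
qed

lemma eventually_in_growing_interval:
  assumes "\<And>n. a n \<le> - real n - 1" "\<And>n. real n + 1 \<le> b n"
  shows "\<forall>\<^sub>F n in sequentially. x \<in> {a n<..<b n}"
proof -
  have "\<forall>\<^sub>F n in sequentially. \<bar>x\<bar> < real n"
    using filterlim_real_sequentially by (simp add: filterlim_at_top_dense)
  then show ?thesis
  proof eventually_elim
    case (elim n)
    then show ?case using assms[of n] by auto
  qed
qed

lemma integral_interval_exhaustion: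
  fixes h :: "real \<Rightarrow> complex"
  assumes int: "integrable lborel h"
    and ab: "\<And>n. a n \<le> - real n - 1" "\<And>n. real n + 1 \<le> b n"
  shows "(\<lambda>n. integral {a n..b n} h) \<longlonglongrightarrow> integral\<^sup>L lborel h"
proof -
  have "(\<lambda>n. LINT x|lborel. indicator {a n..b n} x *\<^sub>R h x) \<longlonglongrightarrow> integral\<^sup>L lborel h"
  proof (rule integral_exhaustion[OF int])
    show "\<forall>\<^sub>F n in sequentially. x \<in> {a n..b n}" for x
      using eventually_in_growing_interval[OF ab, of x] by eventually_elim auto
  qed auto
  moreover have "(LINT x|lborel. indicator {a n..b n} x *\<^sub>R h x) = integral {a n..b n} h" for n
  proof -
    have "set_integrable lborel {a n..b n} h"
      unfolding set_integrable_def by (rule integrable_mult_indicator[OF _ int]) simp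
    from set_borel_integral_eq_integral(2)[OF this] show ?thesis by (simp add: set_lebesgue_integral_def)
  qed
  ultimately show ?thesis by simp
qed

lemma summable_exponential_weights:
  assumes "summable (\<lambda>k. norm (b k))"
  shows "summable (\<lambda>k. if \<bar>l k\<bar> \<le> R then norm (c * (b k * wave (- l k) (\<i> * of_real s))) else 0)"
proof (rule summable_comparison_test'[OF summable_mult2[OF assms, of "norm c * exp (2 * pi * R * \<bar>s\<bar>)"]])
  fix k
  have "norm (wave (- l k) (\<i> * of_real s)) \<le> exp (2 * pi * R * \<bar>s\<bar>)" if "\<bar>l k\<bar> \<le> R"
    using that by (intro norm_wave_le) auto
  then have "norm (c * (b k * wave (- l k) (\<i> * of_real s))) \<le> norm (b k) * (norm c * exp (2 * pi * R * \<bar>s\<bar>))" if "\<bar>l k\<bar> \<le> R"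
    unfolding norm_mult using that
    by (subst mult.assoc[symmetric], subst mult.assoc[symmetric], subst mult.commute[of "norm (b k)"])
       (intro mult_left_mono mult_nonneg_nonneg norm_ge_zero)
  then show "norm (if \<bar>l k\<bar> \<le> R then norm (c * (b k * wave (- l k) (\<i> * of_real s))) else 0)
      \<le> norm (b k) * (norm c * exp (2 * pi * R * \<bar>s\<bar>))" by simp
qed

context exponential_sum
begin

lemma reflected: "exponential_sum q (\<lambda>n. - w n) W"
  by standard (use coeffs freqs in auto)

lemma expsum_reflected: "expsum q (\<lambda>n. - w n) z = f (- z)"
  by (simp add: expsum_def wave_def)

lemma deriv_expsum_reflected: "deriv (expsum q (\<lambda>n. - w n)) z = - deriv f (- z)"
proof (rule DERIV_imp_deriv)
  have "(f has_field_derivative deriv f (- z)) (at (- z))" unfolding deriv_expsum by (rule expsum_deriv)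
  then have "((\<lambda>z. f (- z)) has_field_derivative deriv f (- z) * - 1) (at z)"
    by (rule DERIV_chain2) (auto intro!: derivative_eq_intros)
  then show "(expsum q (\<lambda>n. - w n) has_field_derivative - deriv f (- z)) (at z)"
    by (simp add: expsum_reflected[abs_def])
qed

text \<open>The lower half-plane is reduced to the upper one by the reflection \<open>z \<mapsto> - z\<close>, which negates
  the frequencies.\<close>

lemma log_deriv_on_both_lines:
  assumes real_zeros: "\<And>z. f z = 0 \<Longrightarrow> Im z = 0"
  obtains s B where "0 < s" "wave_series (\<lambda>x. deriv f (Complex x s) / f (Complex x s)) B"
    "wave_series (\<lambda>x. deriv f (Complex x (- s)) / f (Complex x (- s))) B"
proof -
  interpret R: exponential_sum q "\<lambda>n. - w n" W by (rule reflected)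
  have "f z \<noteq> 0" if "0 < Im z" for z using real_zeros[of z] that by auto
  moreover have "R.f z \<noteq> 0" if "0 < Im z" for z using real_zeros[of "- z"] that by (auto simp: expsum_reflected)
  ultimately have "\<forall>\<^sub>F s in at_top. (\<exists>B. wave_series (\<lambda>x. deriv f (Complex x s) / f (Complex x s)) B) \<and>
      (\<exists>B. wave_series (\<lambda>x. deriv R.f (Complex x s) / R.f (Complex x s)) B) \<and> 0 < s"
    by (intro eventually_conj log_deriv_wave_series R.log_deriv_wave_series eventually_gt_at_top)
  then obtain s where "\<exists>B. wave_series (\<lambda>x. deriv f (Complex x s) / f (Complex x s)) B"
      "\<exists>B. wave_series (\<lambda>x. deriv R.f (Complex x s) / R.f (Complex x s)) B" "0 < s"
    using eventually_happens'[OF trivial_limit_at_top_linorder] by blast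
  then obtain B1 B2 where B: "wave_series (\<lambda>x. deriv f (Complex x s) / f (Complex x s)) B1"
      "wave_series (\<lambda>x. deriv R.f (Complex x s) / R.f (Complex x s)) B2" by blast
  from B(2) obtain b l where b: "summable (\<lambda>k. norm (b k))" "(\<Sum>k. norm (b k)) \<le> B2"
    "\<And>x. deriv R.f (Complex x s) / R.f (Complex x s) = (\<Sum>k. b k * wave (l k) (of_real x))"
    unfolding wave_series_def by blast
  have "wave_series (\<lambda>x. deriv f (Complex x (- s)) / f (Complex x (- s))) B2"
  proof (rule wave_seriesI[where b = "\<lambda>k. - b k" and l = "\<lambda>k. - l k"])
    fix x
    have "deriv f (Complex x (- s)) / f (Complex x (- s)) = - (deriv R.f (Complex (- x) s) / R.f (Complex (- x) s))"
    proof -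
      have "- Complex (- x) s = Complex x (- s)" by (simp add: complex_eq_iff)
      then show ?thesis by (simp add: expsum_reflected deriv_expsum_reflected)
    qed
    also have "\<dots> = (\<Sum>k. - (b k * wave (l k) (of_real (- x))))"
      unfolding b(3)
      by (rule suminf_minus[symmetric], rule summable_norm_cancel) (use b(1) in \<open>simp only: norm_mult norm_wave_real mult_1_right\<close>)
    finally show "deriv f (Complex x (- s)) / f (Complex x (- s)) = (\<Sum>k. - b k * wave (- l k) (of_real x))"
      by (simp add: wave_def)
  qed (use b in auto)
  then show ?thesis
    using that[OF \<open>0 < s\<close>, of "max B1 B2"] B(1) wave_series_mono max.cobounded1 max.cobounded2 by blast
qed

text \<open>The upper line contributes point masses at the frequencies of its series with the opposite sign
  to the lower line, because the boundary of a rectangle traverses it backwards.\<close>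

theorem zero_measure_fourier_pure_point:
  assumes real_zeros: "\<And>z. f z = 0 \<Longrightarrow> Im z = 0"
  shows "tempered_measure (zero_measure f) \<and>
    is_pure_point_measure (fourier_distribution (measure_distribution (zero_measure f)))"
proof -
  let ?\<mu> = "zero_measure f"
  define g0 where "g0 z = deriv f z / f z" for z
  have f_hol: "f holomorphic_on UNIV" by (rule expsum_holomorphic)
  have fi: "f \<i> \<noteq> 0" using real_zeros[of \<i>] by auto
  obtain s B where s: "0 < s" and up: "wave_series (\<lambda>x. g0 (Complex x s)) B"
    and lo: "wave_series (\<lambda>x. g0 (Complex x (- s))) B"
    using log_deriv_on_both_lines[OF real_zeros] unfolding g0_def by blast
  have B0: "0 \<le> B" using wave_series_norm_le[OF up, of 0] norm_ge_zero order_trans by blast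
  obtain d where d: "0 < d" "\<And>T. \<exists>T'\<in>{T..T+1}. \<forall>y\<in>{-s..s}. d \<le> norm (f (Complex T' y))"
    using good_verticals[OF fi, of s] by blast
  from d(2) have "\<forall>t. \<exists>T'. T' \<in> {t..t+1} \<and> (\<forall>y\<in>{-s..s}. d \<le> norm (f (Complex T' y)))" by blast
  from choice[OF this] obtain \<tau> where \<tau>: "\<And>t. \<tau> t \<in> {t..t+1}"
    "\<And>t y. y \<in> {-s..s} \<Longrightarrow> d \<le> norm (f (Complex (\<tau> t) y))" by blast
  have f\<tau>: "f (of_real (\<tau> t)) \<noteq> 0" for t
    using \<tau>(2)[of 0 t] s d(1) by (auto simp: complex_of_real_def)
  interpret D: exponential_sum "\<lambda>n. 2 * of_real pi * \<i> * of_real (w n) * q n" w W by (rule derivative_series)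
  define V where "V = D.Q * exp (2 * pi * W * s) / d"
  have V: "norm (g0 (Complex (\<tau> t) y)) \<le> V" if "\<bar>y\<bar> \<le> s" for t y
  proof -
    have "norm (deriv f (Complex (\<tau> t) y)) \<le> D.Q * exp (2 * pi * W * s)"
      unfolding deriv_expsum by (rule D.norm_expsum_le) (use that in simp)
    then show ?thesis unfolding g0_def V_def norm_divide
      using \<tau>(2)[of y t] that d(1) D.Q_nonneg by (intro frac_le) (auto simp: abs_le_iff)
  qed
  have V0: "0 \<le> V" unfolding V_def using d(1) D.Q_nonneg by simp
  have cont: "continuous_on S (\<lambda>x. g0 (Complex x y))" if "y \<noteq> 0" for S y
  proof -
    have "g0 holomorphic_on {z. Im z \<noteq> 0}"
      unfolding g0_def using real_zeros holomorphic_deriv[OF f_hol open_UNIV] f_hol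
      by (intro holomorphic_on_divide) (auto intro: holomorphic_on_subset)
    then have "continuous_on {z. Im z \<noteq> 0} g0" by (rule holomorphic_on_imp_continuous_on)
    then show ?thesis unfolding Complex_eq
      by (rule continuous_on_compose2) (use that in \<open>auto intro!: continuous_intros\<close>)
  qed
  have zpos: "0 \<le> zorder f (of_real x)" for x
  proof -
    have "\<exists>w\<in>UNIV. f w \<noteq> 0" using fi by blast
    from conjunct1[OF zorder_exist_zero[OF f_hol open_UNIV connected_UNIV UNIV_I this, of "of_real x"]]
    show ?thesis by (auto split: if_splits)
  qed
  define C where "C = (4 * s * V + 6 * B) / (2 * pi)"
  have C0: "0 \<le> C" unfolding C_def using s V0 B0 by (intro divide_nonneg_nonneg add_nonneg_nonneg mult_nonneg_nonneg) auto
  \<comment> \<open>the argument principle with \<open>\<Phi> = 1\<close> counts the zeros between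
    good verticals on both sides of the interval, at most \<open>3\<close> apart\<close>
  have mass: "emeasure ?\<mu> {t..t+1} \<le> ennreal C" for t
  proof -
    define a b where "a = \<tau> (t - 1)" and "b = \<tau> (t + 1)"
    have ab: "t - 1 \<le> a" "a \<le> t" "t + 1 \<le> b" "b \<le> t + 2"
      using \<tau>(1)[of "t - 1"] \<tau>(1)[of "t + 1"] by (auto simp: a_def b_def)
    have fab: "f (of_real a) \<noteq> 0" "f (of_real b) \<noteq> 0" using f\<tau> by (simp_all add: a_def b_def)
    let ?Z = "{x. a < x \<and> x < b \<and> f (of_real x) = 0}"
    let ?S = "\<Sum>x\<in>?Z. real (nat (zorder f (of_real x)))"
    have M: "norm (deriv f (Complex x y) * 1 / f (Complex x y)) \<le> V" if "x \<in> {a, b}" "\<bar>y\<bar> \<le> s" for x y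
      using V[OF that(2)] that(1) by (auto simp: g0_def a_def b_def)
    have "a < b" using ab by linarith
    note rz = rectangle_zero_sum[OF f_hol holomorphic_on_const real_zeros \<open>a < b\<close> s fab M]
    have fin: "finite ?Z" by (rule rz(1))
    have line: "norm (integral {a..b} (\<lambda>x. g0 (Complex x y))) \<le> B * 3" if "y \<in> {s, - s}" for y
    proof -
      have "norm (integral {a..b} (\<lambda>x. g0 (Complex x y))) \<le> B * (b - a)"
        using ab that s wave_series_norm_le[OF up] wave_series_norm_le[OF lo]
        by (intro integral_bound cont) auto
      also have "\<dots> \<le> B * 3" using ab B0 by (intro mult_left_mono) auto
      finally show ?thesis .
    qed
    have "2 * of_real pi * \<i> * (\<Sum>x\<in>?Z. 1 * of_int (zorder f (of_real x))) = 2 * of_real pi * \<i> * of_real ?S"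
      using zpos by simp
    with rz(2) have "norm (2 * of_real pi * \<i> * of_real ?S
        - (integral {a..b} (\<lambda>x. g0 (Complex x (- s))) - integral {a..b} (\<lambda>x. g0 (Complex x s)))) \<le> 4 * s * V"
      by (simp only: g0_def mult_1_right)
    then have "norm (2 * of_real pi * \<i> * of_real ?S) \<le> 4 * s * V + (B * 3 + B * 3)"
      using line[of s] line[of "- s"]
        norm_triangle_ineq2[of "2 * of_real pi * \<i> * of_real ?S" "integral {a..b} (\<lambda>x. g0 (Complex x (- s))) - integral {a..b} (\<lambda>x. g0 (Complex x s))"]
        norm_triangle_ineq4[of "integral {a..b} (\<lambda>x. g0 (Complex x (- s)))" "integral {a..b} (\<lambda>x. g0 (Complex x s))"]
      by simp
    moreover have "0 \<le> ?S" by (intro sum_nonneg) auto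
    ultimately have "2 * pi * ?S \<le> 4 * s * V + 6 * B" by (simp add: norm_mult del: of_real_sum of_nat_nat)
    then have SC: "?S \<le> C" unfolding C_def by (subst pos_le_divide_eq) (auto simp: mult_ac)
    have sub: "{x \<in> {t..t+1}. f (of_real x) = 0} \<subseteq> ?Z"
      using ab fab by (auto simp: less_le)
    have "emeasure ?\<mu> {t..t+1} = (\<Sum>x\<in>{x \<in> {t..t+1}. f (of_real x) = 0}. of_nat (nat (zorder f (of_real x))))"
      by (rule emeasure_zero_measure) (use finite_subset[OF sub fin] in auto)
    also have "\<dots> \<le> (\<Sum>x\<in>?Z. of_nat (nat (zorder f (of_real x))))"
      by (rule sum_mono2[OF fin sub]) simp
    also have "\<dots> = ennreal ?S" by (simp add: ennreal_of_nat_eq_real_of_nat sum_ennreal del: of_nat_nat)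
    also have "\<dots> \<le> ennreal C" using SC by (rule ennreal_leI)
    finally show ?thesis .
  qed
  have int: "integrable ?\<mu> (\<lambda>x. 1 / (1 + x\<^sup>2))"
    by (rule integrable_inverse_square_unit_mass[OF sets_zero_measure mass C0])
  have tempered: "tempered_measure ?\<mu>" by (rule tempered_measureI[OF sets_zero_measure int])

  obtain b l where b: "summable (\<lambda>k. norm (b k))" "\<And>x. g0 (Complex x s) = (\<Sum>k. b k * wave (l k) (of_real x))"
    using up unfolding wave_series_def by blast
  obtain b' l' where b': "summable (\<lambda>k. norm (b' k))" "\<And>x. g0 (Complex x (- s)) = (\<Sum>k. b' k * wave (l' k) (of_real x))"
    using lo unfolding wave_series_def by blast
  let ?U = "\<lambda>\<phi>. LINT x|lborel. fourier_ext \<phi> (Complex x s) * g0 (Complex x s)"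
  let ?L = "\<lambda>\<phi>. LINT x|lborel. fourier_ext \<phi> (Complex x (- s)) * g0 (Complex x (- s))"
  define c where "c = 1 / (2 * of_real pi * \<i>)"
  have c2: "c * (2 * of_real pi * \<i>) = 1" by (simp add: c_def)

  \<comment> \<open>the residue formula on growing rectangles, in the limit\<close>
  have main: "fourier_distribution (measure_distribution ?\<mu>) \<phi> = - c * ?U \<phi> + c * ?L \<phi>" if \<phi>: "\<phi> \<in> test_functions" for \<phi>
  proof -
    define \<Phi> where "\<Phi> = fourier_ext \<phi>"
    obtain K where K: "\<And>z. \<bar>Im z\<bar> \<le> s \<Longrightarrow> norm (\<Phi> z) \<le> K / (1 + (Re z)\<^sup>2)"
      unfolding \<Phi>_def using fourier_ext_decay[OF \<phi>] by blast
    have K0: "0 \<le> K" using K[of 0] s norm_ge_zero[of "\<Phi> 0"] by (simp add: order_trans[OF norm_ge_zero])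
    obtain R where "compactly_supported (vderiv 0 \<phi>) R" using test_function_compactly_supported[OF \<phi>] by blast
    then interpret compactly_supported \<phi> R by simp
    have \<Phi>_hol: "\<Phi> holomorphic_on UNIV" unfolding \<Phi>_def by (rule fourier_ext_holomorphic)
    have "continuous_on UNIV (\<lambda>x::real. \<Phi> (of_real x))"
      by (rule continuous_on_compose2[OF holomorphic_on_imp_continuous_on[OF \<Phi>_hol]]) (auto intro: continuous_intros)
    then have \<Phi>m: "(\<lambda>x::real. \<Phi> (of_real x)) \<in> borel_measurable borel" by (rule borel_measurable_continuous_onI)
    have \<Phi>i: "integrable ?\<mu> (\<lambda>x. \<Phi> (of_real x))"
    proof (rule Bochner_Integration.integrable_bound[OF integrable_mult_right[OF int, of K]])
      show "(\<lambda>x::real. \<Phi> (of_real x)) \<in> borel_measurable ?\<mu>"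
        using \<Phi>m measurable_cong_sets[OF sets_zero_measure refl] by blast
      show "AE x in ?\<mu>. norm (\<Phi> (of_real x)) \<le> norm (K * (1 / (1 + x\<^sup>2)))"
      proof (rule AE_I2)
        fix x :: real
        show "norm (\<Phi> (of_real x)) \<le> norm (K * (1 / (1 + x\<^sup>2)))"
          using K[of "of_real x"] s K0 by simp
      qed
    qed
    \<comment> \<open>good verticals on both sides of \<open>{- n - 1..n + 1}\<close>; there
      \<open>\<Phi>\<close> is of order \<open>1 / n\<^sup>2\<close> and the logarithmic derivative
      is bounded, so the short sides of the rectangles disappear in the limit\<close>
    define a b where "a n = \<tau> (- real n - 2)" and "b n = \<tau> (real n + 1)" for n :: nat
    have ab: "a n \<le> - real n - 1" "real n + 1 \<le> b n" for n
      using \<tau>(1)[of "- real n - 2"] \<tau>(1)[of "real n + 1"] by (auto simp: a_def b_def)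
    let ?Z = "\<lambda>n. {x. a n < x \<and> x < b n \<and> f (of_real x) = 0}"
    let ?S = "\<lambda>n. \<Sum>x\<in>?Z n. \<Phi> (of_real x) * of_int (zorder f (of_real x))"
    let ?I = "\<lambda>n y. integral {a n..b n} (\<lambda>x. \<Phi> (Complex x y) * g0 (Complex x y))"
    have rect: "finite (?Z n)" "norm (2 * of_real pi * \<i> * ?S n - (?I n (- s) - ?I n s)) \<le> 4 * s * (V * K / (1 + (real n + 1)\<^sup>2))" for n
    proof -
      have "a n < b n" using ab[of n] by linarith
      have fab: "f (of_real (a n)) \<noteq> 0" "f (of_real (b n)) \<noteq> 0" using f\<tau> by (simp_all add: a_def b_def)
      have M: "norm (deriv f (Complex x y) * \<Phi> (Complex x y) / f (Complex x y)) \<le> V * K / (1 + (real n + 1)\<^sup>2)"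
        if "x \<in> {a n, b n}" "\<bar>y\<bar> \<le> s" for x y
      proof -
        have "norm (g0 (Complex x y)) \<le> V" using V[OF that(2)] that(1) by (auto simp: a_def b_def)
        moreover have "norm (\<Phi> (Complex x y)) \<le> K / (1 + (real n + 1)\<^sup>2)"
        proof -
          have "(real n + 1)\<^sup>2 \<le> x\<^sup>2" using ab[of n] that(1) power_mono[of "real n + 1" "\<bar>x\<bar>" 2] by auto
          then have "K / (1 + x\<^sup>2) \<le> K / (1 + (real n + 1)\<^sup>2)"
            using K0 by (intro divide_left_mono mult_pos_pos add_pos_nonneg) auto
          then show ?thesis using K[of "Complex x y"] that(2) by simp
        qed
        ultimately have "norm (g0 (Complex x y)) * norm (\<Phi> (Complex x y)) \<le> V * (K / (1 + (real n + 1)\<^sup>2))"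
          using V0 by (intro mult_mono) auto
        then show ?thesis by (simp add: g0_def norm_mult norm_divide mult_ac)
      qed
      note rz = rectangle_zero_sum[OF f_hol \<Phi>_hol real_zeros \<open>a n < b n\<close> s fab M]
      have g0: "deriv f z * \<Phi> z / f z = \<Phi> z * g0 z" for z by (simp add: g0_def)
      show "finite (?Z n)" by (rule rz(1))
      show "norm (2 * of_real pi * \<i> * ?S n - (?I n (- s) - ?I n s)) \<le> 4 * s * (V * K / (1 + (real n + 1)\<^sup>2))"
        using rz(2) unfolding g0 .
    qed
    have S_eq: "?S n = (LINT x|?\<mu>. indicator {a n<..<b n} x *\<^sub>R \<Phi> (of_real x))" for n
    proof -
      have Z: "{x \<in> {a n<..<b n}. f (of_real x) = 0} = ?Z n" by auto
      have "(LINT x|?\<mu>. indicator {a n<..<b n} x *\<^sub>R \<Phi> (of_real x))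
          = (\<Sum>x\<in>?Z n. of_nat (nat (zorder f (of_real x))) * \<Phi> (of_real x))"
        using integral_zero_measure[of "{a n<..<b n}" "\<lambda>x. \<Phi> (of_real x)" f] \<Phi>m rect(1)[of n] by (simp add: Z)
      also have "\<dots> = ?S n" using zpos by (intro sum.cong) (simp_all add: mult.commute)
      finally show ?thesis by simp
    qed
    have limS: "?S \<longlonglongrightarrow> (LINT x|?\<mu>. \<Phi> (of_real x))"
      unfolding S_eq by (rule integral_exhaustion[OF \<Phi>i _ eventually_in_growing_interval[OF ab]]) simp
    have "integrable lborel (\<lambda>x. \<Phi> (Complex x s) * g0 (Complex x s))"
      unfolding \<Phi>_def b(2) by (rule fourier_ext_pairing(1)[OF \<phi> b(1)])
    then have limU: "(\<lambda>n. ?I n s) \<longlonglongrightarrow> ?U \<phi>"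
      unfolding \<Phi>_def by (rule integral_interval_exhaustion) (use ab in auto)
    have "integrable lborel (\<lambda>x. \<Phi> (Complex x (- s)) * g0 (Complex x (- s)))"
      unfolding \<Phi>_def b'(2) by (rule fourier_ext_pairing(1)[OF \<phi> b'(1)])
    then have limL: "(\<lambda>n. ?I n (- s)) \<longlonglongrightarrow> ?L \<phi>"
      unfolding \<Phi>_def by (rule integral_interval_exhaustion) (use ab in auto)
    have lim0: "(\<lambda>n. 2 * of_real pi * \<i> * ?S n - (?I n (- s) - ?I n s)) \<longlonglongrightarrow> 0"
    proof (rule Lim_null_comparison)
      show "\<forall>\<^sub>F n in sequentially. norm (2 * of_real pi * \<i> * ?S n - (?I n (- s) - ?I n s)) \<le> 4 * s * (V * K / (1 + (real n + 1)\<^sup>2))"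
        using rect(2) by (intro always_eventually allI)
      show "(\<lambda>n. 4 * s * (V * K / (1 + (real n + 1)\<^sup>2))) \<longlonglongrightarrow> 0" by real_asymp
    qed
    have "2 * of_real pi * \<i> * (LINT x|?\<mu>. \<Phi> (of_real x)) - (?L \<phi> - ?U \<phi>) = 0"
    proof (rule LIMSEQ_unique[OF _ lim0])
      show "(\<lambda>n. 2 * of_real pi * \<i> * ?S n - (?I n (- s) - ?I n s)) \<longlonglongrightarrow>
        2 * of_real pi * \<i> * (LINT x|?\<mu>. \<Phi> (of_real x)) - (?L \<phi> - ?U \<phi>)"
        by (intro tendsto_intros limS limU limL)
    qed
    then have "c * (2 * of_real pi * \<i>) * (LINT x|?\<mu>. \<Phi> (of_real x)) = c * (?L \<phi> - ?U \<phi>)"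
      by (simp only: mult.assoc right_minus_eq)
    then have "(LINT x|?\<mu>. \<Phi> (of_real x)) = c * (?L \<phi> - ?U \<phi>)"
      unfolding c2 by simp
    then show ?thesis
      by (simp add: fourier_distribution_def measure_distribution_def fourier_eq_fourier_ext[abs_def] \<Phi>_def algebra_simps)
  qed
  have pure: "is_pure_point_measure (\<lambda>\<phi>. - c * ?U \<phi> + c * ?L \<phi>)"
  proof (rule pure_point_of_two_series)
    show "summable (\<lambda>k. if \<bar>l k\<bar> \<le> R then norm (- c * (b k * wave (- l k) (\<i> * of_real s))) else 0)" for R
      by (rule summable_exponential_weights[OF b(1)])
    show "summable (\<lambda>k. if \<bar>l' k\<bar> \<le> R then norm (c * (b' k * wave (- l' k) (\<i> * of_real (- s)))) else 0)" for R
      by (rule summable_exponential_weights[OF b'(1)])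
    show "(\<lambda>k. - c * (b k * wave (- l k) (\<i> * of_real s)) * \<phi> (l k)) sums (- c * ?U \<phi>)" if "\<phi> \<in> test_functions" for \<phi>
      using sums_mult[OF fourier_ext_pairing(2)[OF that b(1), where l = l and s = s], of "- c"]
      unfolding b(2) by (simp only: mult.assoc)
    show "(\<lambda>k. c * (b' k * wave (- l' k) (\<i> * of_real (- s))) * \<phi> (l' k)) sums (c * ?L \<phi>)" if "\<phi> \<in> test_functions" for \<phi>
      using sums_mult[OF fourier_ext_pairing(2)[OF that b'(1), where l = l' and s = "- s"], of c]
      unfolding b'(2) by (simp only: mult.assoc)
  qed
  have "is_pure_point_measure (fourier_distribution (measure_distribution ?\<mu>))"
    by (rule iffD2[OF is_pure_point_measure_cong pure]) (rule main)
  with tempered show ?thesis by blast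
qed

end

theorem theorem2:
  fixes N :: "nat set" and q :: "nat \<Rightarrow> complex" and \<omega> :: "nat \<Rightarrow> real"
    and f :: "complex \<Rightarrow> complex"
  assumes "\<And>n. n \<in> N \<Longrightarrow> q n \<noteq> 0"
    and "inj_on \<omega> N"
    and "bounded (\<omega> ` N)"
    and "(\<lambda>n. norm (q n)) summable_on N"
    and "\<And>z. f z = (\<Sum>\<^sub>\<infinity>n\<in>N. q n * exp (2 * of_real pi * \<i> * of_real (\<omega> n) * z))"
    and "\<And>z. f z = 0 \<Longrightarrow> z \<in> \<real>"
  shows "tempered_measure (zero_measure f) \<and>
    is_pure_point_measure (fourier_distribution (measure_distribution (zero_measure f)))"
proof -
  \<comment> \<open>extending by zero outside \<open>N\<close> gives a series over all natural
    numbers\<close>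
  let ?q = "\<lambda>n. if n \<in> N then q n else 0" and ?w = "\<lambda>n. if n \<in> N then \<omega> n else 0"
  obtain W where W: "\<And>n. n \<in> N \<Longrightarrow> \<bar>\<omega> n\<bar> \<le> W" using assms(3) by (auto simp: bounded_iff)
  have "(\<lambda>n. norm (?q n)) summable_on UNIV"
    using assms(4) by (rule summable_on_cong_neutral[THEN iffD1, rotated 3]) auto
  then have sq: "summable (\<lambda>n. norm (?q n))" by (rule summable_on_imp_summable)
  interpret exponential_sum ?q ?w "\<bar>W\<bar>"
    by standard (use sq order_trans[OF W abs_ge_self] in auto)
  have feq: "f = expsum ?q ?w"
  proof
    fix z
    have "expsum ?q ?w z = infsum (\<lambda>n. ?q n * wave (?w n) z) UNIV"
      by (rule infsumI[symmetric], rule norm_summable_imp_has_sum[OF summable_norm_terms expsum_sums])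
    also have "\<dots> = (\<Sum>\<^sub>\<infinity>n\<in>N. q n * exp (2 * of_real pi * \<i> * of_real (\<omega> n) * z))"
      by (rule infsum_cong_neutral) (auto simp: wave_def)
    finally show "f z = expsum ?q ?w z" using assms(5) by simp
  qed
  show ?thesis
    unfolding feq by (rule zero_measure_fourier_pure_point) (use assms(6) feq complex_is_Real_iff in auto)
qed

end
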